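(* Fix a finite field $\mathbb{F}_q$ and a natural number $m$. Let $\mathcal{C}$ be a family of isomorphism classes of $m$-dimensional linear codes over $\mathbb{F}_q$, of varying lengths, that is preserved under puncturing. Then for $n\gg 0$ the number of length-$n$ elements in $\mathcal{C}$ is a quasipolynomial in $n$; that is, there exist a quasipolynomial $f:\mathbb{Z}\to\mathbb{R}$ and an $n_0$ such that for all $n\ge n_0$ the number of isomorphism classes of length-$n$ codes belonging to $\mathcal{C}$ equals $f(n)$.
   Context: A linear code of length $n$ and dimension $m$ over $\mathbb{F}_q$ is an $m$-dimensional linear subspace of $\mathbb{F}_q^n$. Two codes in $\mathbb{F}_q^n$ are isomorphic if one is obtained from the other by the action of an element of the group generated by: $\mathrm{Sym}([n])$ permuting the coordinates; $(\mathbb{F}_q^* )^n$ scaling the coordinates by nonzero scalars; and $\mathrm{Aut}(\mathbb{F}_q)$ acting simultaneously on all coordinates. Puncturing a code means deleting a coordinate (i.e. projecting the code to the remaining coordinates); this is only allowed when the dimension of the code does not drop. The family $\mathcal{C}$ is preserved under puncturing if whenever the class of a code belongs to $\mathcal{C}$, so does the class of every code obtained from it by an allowed puncturing. A quasipolynomial is a function $f:\mathbb{Z}\to\mathbb{R}$ of the form $f(n)=c_d(n)n^d+\cdots+c_0(n)$ where each $c_i:\mathbb{Z}\to\mathbb{R}$ is periodic with integral period. *)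

theory Defs
  imports
    "HOL-Algebra.Bij"
    "HOL-Algebra.Generated_Groups"
    "HOL-Algebra.QuotRing"
    "HOL-Combinatorics.Permutations"
    "Jordan_Normal_Form.VS_Connect"
begin

text \<open>
  The finite field is a type \<open>'k :: {field, finite}\<close>, and the space of words of length \<open>n\<close>
  is \<open>carrier_vec n\<close>.  A \<open>'k vec\<close> carries its own dimension and a subspace is nonempty, so codes
  of different lengths are different sets.
\<close>

definition code_dim :: "nat \<Rightarrow> 'k::field vec set \<Rightarrow> nat" where
  "code_dim n C = vectorspace.dim class_ring ((module_vec TYPE('k) n)\<lparr>carrier := C\<rparr>)"

definition linear_code :: "nat \<Rightarrow> nat \<Rightarrow> 'k::field vec set \<Rightarrow> bool" where
  "linear_code m n C \<longleftrightarrow>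
     subspace class_ring C (module_vec TYPE('k) n) \<and> code_dim n C = m"

text \<open>
  The three kinds of generators, as elements of the group \<open>BijGroup (carrier_vec n)\<close> of all
  bijections of the space of words (whose elements are \<open>undefined\<close> outside \<open>carrier_vec n\<close>).
\<close>

definition coord_perms :: "nat \<Rightarrow> ('k::field vec \<Rightarrow> 'k vec) set" where
  "coord_perms n =
     {\<lambda>v\<in>carrier_vec n. vec n (\<lambda>i. v $ \<pi> i) | \<pi>. \<pi> permutes {..<n}}"

definition coord_scalings :: "nat \<Rightarrow> ('k::field vec \<Rightarrow> 'k vec) set" where
  "coord_scalings n =
     {\<lambda>v\<in>carrier_vec n. vec n (\<lambda>i. a i * v $ i) | a. \<forall>i<n. a i \<noteq> 0}"

definition field_auts :: "nat \<Rightarrow> ('k::field vec \<Rightarrow> 'k vec) set" where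
  "field_auts n =
     {\<lambda>v\<in>carrier_vec n. map_vec \<tau> v | \<tau>. \<tau> \<in> ring_iso class_ring class_ring}"

definition code_group :: "nat \<Rightarrow> ('k::field vec \<Rightarrow> 'k vec) set" where
  "code_group n =
     generate (BijGroup (carrier_vec n)) (coord_perms n \<union> coord_scalings n \<union> field_auts n)"

definition code_iso :: "nat \<Rightarrow> 'k::field vec set \<Rightarrow> 'k vec set \<Rightarrow> bool" where
  "code_iso n C D \<longleftrightarrow> (\<exists>g\<in>code_group n. D = g ` C)"

definition code_class :: "nat \<Rightarrow> nat \<Rightarrow> 'k::field vec set \<Rightarrow> 'k vec set set" where
  "code_class m n C = {D. linear_code m n D \<and> code_iso n C D}"

definition code_classes :: "nat \<Rightarrow> nat \<Rightarrow> 'k::field vec set set set" where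
  "code_classes m n = {code_class m n C | C. linear_code m n C}"

definition delete_coord :: "nat \<Rightarrow> 'k vec \<Rightarrow> 'k vec" where
  "delete_coord j v = vec (dim_vec v - 1) (\<lambda>i. v $ (if i < j then i else Suc i))"

definition puncture :: "nat \<Rightarrow> 'k vec set \<Rightarrow> 'k vec set" where
  "puncture j C = delete_coord j ` C"

definition puncturing_closed :: "nat \<Rightarrow> 'k::field vec set set set \<Rightarrow> bool" where
  "puncturing_closed m \<C> \<longleftrightarrow>
     (\<forall>n C. \<forall>j<n. linear_code m n C \<and> code_class m n C \<in> \<C>
        \<and> code_dim (n - 1) (puncture j C) = code_dim n C
        \<longrightarrow> code_class m (n - 1) (puncture j C) \<in> \<C>)"

definition quasipolynomial :: "(int \<Rightarrow> real) \<Rightarrow> bool" where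
  "quasipolynomial f \<longleftrightarrow>
     (\<exists>d::nat. \<exists>c :: nat \<Rightarrow> int \<Rightarrow> real.
        (\<forall>i\<le>d. \<exists>p>0. \<forall>n. c i (n + p) = c i n) \<and>
        (\<forall>n. f n = (\<Sum>i\<le>d. c i n * of_int n ^ i)))"

end

theory Submission
  imports Defs "HOL-Library.Cardinality"
begin

text \<open>
  A code of length \<open>n\<close> and dimension \<open>m\<close> is the row space of a matrix with \<open>m\<close> independent rows, and a column
  of this matrix matters only up to a scalar. So a code is, up to isomorphism, a multiset of
  \<open>n\<close> elements of the finite set \<open>X\<close> of scalar classes of vectors of length \<open>m\<close> (the class of
  \<open>0\<close> included) which spans the whole space, and isomorphism is the action on \<open>X\<close> of the finite
  group \<open>G\<close> induced by the semilinear bijections. Puncturing removes one element of the multiset,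
  so a family closed under puncturing corresponds to a difference of two up-closed \<open>G\<close>-invariant
  sets of functions \<open>X \<Rightarrow> nat\<close>: the spanning ones, and the spanning ones outside the family
  together with everything above them. By Burnside's lemma it remains to count, for each
  \<open>\<sigma> \<in> G\<close>, the \<open>\<sigma>\<close>-fixed functions of total \<open>n\<close> in an up-closed set. These are functions on the
  cycles of \<open>\<sigma>\<close>, and induction on the number of cycles gives a quasipolynomial count, because
  the slices along one coordinate stabilise.
\<close>

section \<open>Eventually quasipolynomial sequences\<close>

text \<open>A puncturing that lowers the dimension is forbidden, so the family is closed downwards
  only among spanning multisets. Neither it nor its complement need be monotone among all multisets,
  and monotonicity is regained by writing it as one up-closed set minus another. Periods enter
  through Burnside's lemma: a cycle of length \<open>w\<close> contributes only multiples of
  \<open>w\<close> to the code length, so the count along one cycle satisfies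
  \<open>h (n + w) = h n + c n\<close>, whose solutions are quasipolynomial rather than polynomial.
  Stabilisation of slices is where finiteness enters. It rests on Dickson's lemma, used through
  monotone subsequences, so no generating set of an up-closed set is ever needed; the argument is
  not effective and gives no explicit bound for the length from which the formula holds. The class
  of \<open>0\<close> has to be kept because a code may have coordinates that vanish
  identically.\<close>

text \<open>Each residue class carries an ordinary polynomial, so shifts and antidifferences are
  operations on polynomials. Periodic coefficient functions appear only in
  \<open>eventually_qp_imp_quasipolynomial\<close>.\<close>

definition eventually_qp :: "(nat \<Rightarrow> real) \<Rightarrow> bool" where
  "eventually_qp a \<longleftrightarrow>
     (\<exists>p>0. \<exists>n\<^sub>0. \<exists>P :: nat \<Rightarrow> real poly. \<forall>n\<ge>n\<^sub>0. a n = poly (P (n mod p)) (real n))"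

lemma eventually_qpI:
  assumes "p > 0" and "\<And>n. n \<ge> n\<^sub>0 \<Longrightarrow> a n = poly (P (n mod p)) (real n)"
  shows "eventually_qp a"
  using assms unfolding eventually_qp_def by blast

lemma eventually_qpE:
  assumes "eventually_qp a"
  obtains p n\<^sub>0 P where "p > 0"
    and "\<And>n. n \<ge> n\<^sub>0 \<Longrightarrow> a n = poly (P (n mod p)) (real n)"
  using assms unfolding eventually_qp_def by blast

lemma eventually_qp_const: "eventually_qp (\<lambda>n. c)"
  by (rule eventually_qpI[of 1 0 _ "\<lambda>_. [:c:]"]) auto

lemma eventually_qp_cmult:
  assumes "eventually_qp a"
  shows "eventually_qp (\<lambda>n. c * a n)"
proof -
  from assms obtain p n0 P where
    "p > 0" "\<And>n. n \<ge> n0 \<Longrightarrow> a n = poly (P (n mod p)) (real n)"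
    by (rule eventually_qpE) blast
  then show ?thesis
    by (intro eventually_qpI[of p n0 _ "\<lambda>r. Polynomial.smult c (P r)"]) auto
qed

lemma eventually_qp_add:
  assumes "eventually_qp a" and "eventually_qp b"
  shows "eventually_qp (\<lambda>n. a n + b n)"
proof -
  from assms(1) obtain p n1 P where P:
    "p > 0" "\<And>n. n \<ge> n1 \<Longrightarrow> a n = poly (P (n mod p)) (real n)"
    by (rule eventually_qpE) blast
  from assms(2) obtain q n2 Q where Q:
    "q > 0" "\<And>n. n \<ge> n2 \<Longrightarrow> b n = poly (Q (n mod q)) (real n)"
    by (rule eventually_qpE) blast
  show ?thesis
  proof (rule eventually_qpI[of "p * q" "max n1 n2" _ "\<lambda>r. P (r mod p) + Q (r mod q)"])
    fix n assume "n \<ge> max n1 n2"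
    moreover have "n mod (p * q) mod p = n mod p" "n mod (p * q) mod q = n mod q"
      by (simp_all add: mod_mod_cancel)
    ultimately show "a n + b n
        = poly (P (n mod (p * q) mod p) + Q (n mod (p * q) mod q)) (real n)"
      using P Q by simp
  qed (use P Q in simp)
qed

lemma eventually_qp_diff:
  assumes "eventually_qp a" and "eventually_qp b"
  shows "eventually_qp (\<lambda>n. a n - b n)"
  using eventually_qp_add[OF assms(1) eventually_qp_cmult[OF assms(2), of "-1"]] by simp

lemma eventually_qp_sum:
  assumes "\<And>i. i \<in> I \<Longrightarrow> eventually_qp (a i)"
  shows "eventually_qp (\<lambda>n. \<Sum>i\<in>I. a i n)"
  using assms
  by (induction I rule: infinite_finite_induct)
     (simp_all add: eventually_qp_const eventually_qp_add)

lemma eventually_qp_cong: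
  assumes "eventually_qp a" and "\<And>n. n \<ge> N \<Longrightarrow> b n = a n"
  shows "eventually_qp b"
proof -
  from assms(1) obtain p n0 P where
    "p > 0" "\<And>n. n \<ge> n0 \<Longrightarrow> a n = poly (P (n mod p)) (real n)"
    by (rule eventually_qpE) blast
  then show ?thesis
    using assms(2) by (intro eventually_qpI[of p "max n0 N" _ P]) auto
qed

lemma eventually_qp_shift:
  assumes "eventually_qp a"
  shows "eventually_qp (\<lambda>n. a (n + k))"
proof -
  from assms obtain p n0 P where P:
    "p > 0" "\<And>n. n \<ge> n0 \<Longrightarrow> a n = poly (P (n mod p)) (real n)"
    by (rule eventually_qpE) blast
  show ?thesis
  proof (rule eventually_qpI[of p n0 _ "\<lambda>r. pcompose (P ((r + k) mod p)) [:real k, 1:]"])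
    fix n assume "n \<ge> n0"
    then show "a (n + k)
        = poly (pcompose (P ((n mod p + k) mod p)) [:real k, 1:]) (real n)"
      using P(2)[of "n + k"] unfolding mod_add_left_eq
      by (simp add: poly_pcompose add.commute)
  qed (use P in simp)
qed

lemma eventually_qp_delay:
  assumes "eventually_qp a"
  shows "eventually_qp (\<lambda>n. if k \<le> n then a (n - k) else 0)"
proof -
  from assms obtain p n0 P where P:
    "p > 0" "\<And>n. n \<ge> n0 \<Longrightarrow> a n = poly (P (n mod p)) (real n)"
    by (rule eventually_qpE) blast
  show ?thesis
  \<comment> \<open>The natural number \<open>p * k - k\<close> represents \<open>- k\<close> modulo
    \<open>p\<close>; a truncated \<open>r - k\<close> would give the wrong residue for small
    \<open>r\<close>.\<close>
  proof (rule eventually_qpI[of p "n0 + k" _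
        "\<lambda>r. pcompose (P ((r + (p * k - k)) mod p)) [:- real k, 1:]"])
    fix n assume n: "n \<ge> n0 + k"
    have "k \<le> p * k" using P(1) by simp
    then have "n + (p * k - k) = n - k + p * k"
      using n by simp
    then have "(n mod p + (p * k - k)) mod p = (n - k + p * k) mod p"
      unfolding mod_add_left_eq by simp
    then have "(n mod p + (p * k - k)) mod p = (n - k) mod p"
      by simp
    then show "(if k \<le> n then a (n - k) else 0)
        = poly (pcompose (P ((n mod p + (p * k - k)) mod p)) [:- real k, 1:]) (real n)"
      using P n by (simp add: poly_pcompose of_nat_diff)
  qed (use P in simp)
qed

text \<open>Strong induction on the degree \<open>d\<close>. The difference \<open>D\<close> of the
  monomial of degree \<open>Suc d\<close> has degree \<open>d\<close> and leading coefficient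
  \<open>Suc d * w \<noteq> 0\<close>, so a multiple of it cancels the top coefficient of
  \<open>P\<close>.\<close>

lemma poly_antidifference:
  fixes P :: "real poly"
  assumes "w \<noteq> 0"
  shows "\<exists>Q. \<forall>x. poly Q (x + w) - poly Q x = poly P x"
proof (induction "degree P" arbitrary: P rule: less_induct)
  case less
  show ?case
  proof (cases "P = 0")
    case True
    then show ?thesis by (intro exI[of _ 0]) simp
  next
    case False
    define d where "d = degree P"
    define M :: "real poly" where "M = monom 1 (Suc d)"
    define D where "D = pcompose M [:w, 1:] - M"
    have D: "poly D x = (x + w) ^ Suc d - x ^ Suc d" for x
      by (simp add: D_def M_def poly_pcompose poly_monom add.commute)
    have Dsum: "D = (\<Sum>k\<le>d. monom (of_nat (Suc d choose k) * w ^ (Suc d - k)) k)"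
    proof (rule poly_eq_poly_eq_iff[THEN iffD1])
      show "poly D = poly (\<Sum>k\<le>d. monom (of_nat (Suc d choose k) * w ^ (Suc d - k)) k)"
      proof
        fix x
        show "poly D x = poly (\<Sum>k\<le>d. monom (of_nat (Suc d choose k) * w ^ (Suc d - k)) k) x"
          unfolding D binomial_ring[of x w "Suc d"] poly_sum poly_monom
          by (simp add: algebra_simps del: power_Suc binomial_Suc_Suc)
      qed
    qed
    have coeffD: "coeff D k = (if k \<le> d then of_nat (Suc d choose k) * w ^ (Suc d - k) else 0)" for k
      unfolding Dsum coeff_sum coeff_monom by (simp add: if_distrib cong: if_cong)
    define c where "c = coeff P d / (real (Suc d) * w)"
    define R where "R = P - Polynomial.smult c D"
    have "coeff R k = 0" if "k \<ge> d" for k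
    proof (cases "k = d")
      case True
      then show ?thesis using assms by (simp add: R_def coeffD c_def)
    next
      case False
      then show ?thesis using that
        by (simp add: R_def coeffD d_def coeff_eq_0)
    qed
    then have Rlow: "R = 0 \<or> degree R < d"
      by (metis leading_coeff_0_iff linorder_not_less)
    have "\<exists>Q. \<forall>x. poly Q (x + w) - poly Q x = poly R x"
    proof (cases "R = 0")
      case True
      then show ?thesis by (intro exI[of _ 0]) simp
    next
      case False
      then show ?thesis using less Rlow d_def by blast
    qed
    then obtain Q where Q: "\<And>x. poly Q (x + w) - poly Q x = poly R x" by blast
    have "poly (Q + Polynomial.smult c M) (x + w) - poly (Q + Polynomial.smult c M) x = poly P x" for x
    proof -
      have "poly P x = poly R x + c * poly D x" by (simp add: R_def)
      then show ?thesis
        using Q[of x] unfolding D by (simp add: M_def poly_monom algebra_simps)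
    qed
    then show ?thesis by blast
  qed
qed

text \<open>After \<open>p\<close> steps of size \<open>w\<close> the argument has moved by a
  multiple of the period of \<open>c\<close>, so on each residue class modulo
  \<open>W = p * w\<close> the increment of \<open>h\<close> is eventually polynomial. Subtracting a
  polynomial antidifference leaves an eventually periodic remainder \<open>e\<close>.\<close>

lemma eventually_qp_antidifference:
  assumes "eventually_qp c" and "w > 0" and h: "\<And>n. h (n + w) = h n + c n"
  shows "eventually_qp h"
proof -
  from assms(1) obtain p n0 P where P:
    "p > 0" "\<And>n. n \<ge> n0 \<Longrightarrow> c n = poly (P (n mod p)) (real n)"
    by (rule eventually_qpE) blast
  define W where "W = p * w"
  have W: "W > 0" using P assms by (simp add: W_def)
  define C where "C n = (\<Sum>i<p. c (n + i * w))" for n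
  have "h (n + k * w) = h n + (\<Sum>i<k. c (n + i * w))" for n k
  proof (induction k)
    case (Suc k)
    then show ?case using h[of "n + k * w"] by (simp add: algebra_simps)
  qed simp
  then have hW: "h (n + W) = h n + C n" for n
    by (simp add: W_def C_def)
  define S where "S r = (\<Sum>i<p. pcompose (P ((r + i * w) mod p)) [:real (i * w), 1:])" for r
  have CS: "C n = poly (S (n mod W)) (real n)" if "n \<ge> n0" for n
  proof -
    have "c (n + i * w) = poly (pcompose (P ((n mod W + i * w) mod p)) [:real (i * w), 1:]) (real n)"
      for i
    proof -
      have "(n mod W + i * w) mod p = (n + i * w) mod p"
        by (metis W_def dvd_triv_left mod_add_left_eq mod_mod_cancel)
      then show ?thesis using P(2)[of "n + i * w"] that by (simp add: poly_pcompose algebra_simps)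
    qed
    then show ?thesis by (simp add: C_def S_def poly_sum)
  qed
  have "\<forall>r. \<exists>Q. \<forall>x. poly Q (x + real W) - poly Q x = poly (S r) x"
    using poly_antidifference[of "real W"] W by simp
  then obtain Q where Q: "\<And>r x. poly (Q r) (x + real W) - poly (Q r) x = poly (S r) x"
    by metis
  define e where "e n = h n - poly (Q (n mod W)) (real n)" for n
  have e: "e (n + W) = e n" if "n \<ge> n0" for n
    using Q[of "n mod W" "real n"] hW[of n] CS[OF that] by (simp add: e_def add.commute)
  have eW: "e (n + k * W) = e n" if "n \<ge> n0" for n k
  proof (induction k)
    case (Suc k)
    then show ?case using e[of "n + k * W"] that by (simp add: algebra_simps)
  qed simp
  \<comment> \<open>The threshold \<open>n0 * W\<close> is divisible by \<open>W\<close> and at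
    least \<open>n0\<close>, so \<open>n0 * W + n mod W\<close> is a representative of the class of
    \<open>n\<close> in the range where \<open>e\<close> is periodic.\<close>
  have e_mod: "e n = e (n0 * W + n mod W)" if n: "n \<ge> n0 * W" for n
  proof -
    define k where "k = (n - n0 * W) div W"
    have "n = n0 * W + n mod W + k * W"
    proof -
      have "n mod W = (n - n0 * W + n0 * W) mod W" using n by simp
      then have "(n - n0 * W) mod W = n mod W" by simp
      then have "n - n0 * W = n mod W + k * W"
        unfolding k_def by (metis mod_div_mult_eq)
      then show ?thesis using n by linarith
    qed
    moreover have "n0 * W + n mod W \<ge> n0"
      using W by (metis One_nat_def Suc_leI le_add1 le_trans mult.right_neutral mult_le_mono2)
    ultimately show ?thesis using eW by metis
  qed
  show ?thesis
  proof (rule eventually_qpI[of W "n0 * W" _ "\<lambda>r. Q r + [:e (n0 * W + r):]"])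
    fix n assume n: "n \<ge> n0 * W"
    show "h n = poly (Q (n mod W) + [:e (n0 * W + n mod W):]) (real n)"
      using e_mod[OF n] by (simp add: e_def)
  qed (rule W)
qed

lemma eventually_qp_imp_quasipolynomial:
  assumes "eventually_qp a"
  shows "\<exists>f n\<^sub>0. quasipolynomial f \<and> (\<forall>n\<ge>n\<^sub>0. a n = f (int n))"
proof -
  from assms obtain p n0 P where P:
    "p > 0" "\<And>n. n \<ge> n0 \<Longrightarrow> a n = poly (P (n mod p)) (real n)"
    by (rule eventually_qpE) blast
  define R where "R z = P (nat (z mod int p))" for z
  \<comment> \<open>A degree bound common to all residues, so that one summation range serves every
    \<open>z\<close>; missing coefficients are zero.\<close>
  define d where "d = Max ((\<lambda>r. degree (P r)) ` {..<p})"
  have d: "degree (R z) \<le> d" for z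
    unfolding d_def R_def using P(1)
    by (intro Max_ge) (auto intro!: imageI simp: nat_less_iff)
  have "quasipolynomial (\<lambda>z. poly (R z) (of_int z))"
    unfolding quasipolynomial_def
  proof (intro exI conjI allI impI)
    fix i z
    show "int p > 0" using P by simp
    show "coeff (R (z + int p)) i = coeff (R z) i" by (simp add: R_def)
  next
    fix z
    show "poly (R z) (of_int z) = (\<Sum>i\<le>d. coeff (R z) i * of_int z ^ i)"
      unfolding poly_altdef
      by (rule sum.mono_neutral_left) (use d[of z] in \<open>auto simp: coeff_eq_0\<close>)
  qed
  moreover have "a n = poly (R (int n)) (of_int (int n))" if "n \<ge> n0" for n
    using P(2)[OF that] by (simp add: R_def flip: zmod_int)
  ultimately show ?thesis by blast
qed

section \<open>Counting in up-closed sets of functions\<close>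

lemma incseq_subseq_nat:
  fixes s :: "nat \<Rightarrow> nat"
  shows "\<exists>r :: nat \<Rightarrow> nat. strict_mono r \<and> incseq (\<lambda>i. s (r i))"
proof -
  \<comment> \<open>An index whose value is the minimum of the tail starting there. Every tail
    attains its minimum, so such indices are unbounded, and the values along them never
    decrease.\<close>
  define good where "good k \<longleftrightarrow> (\<forall>n\<ge>k. s k \<le> s n)" for k
  have ex_good: "\<exists>k\<ge>N. good k" for N
  proof -
    define k where "k = arg_min s (\<lambda>n. n \<ge> N)"
    have "k \<ge> N" and "s k \<le> s n" if "n \<ge> N" for n
      unfolding k_def using that by (auto intro: arg_min_natI arg_min_nat_le)
    then show ?thesis unfolding good_def by (metis le_refl order_trans)
  qed
  have "\<exists>r. \<forall>n. good (r n) \<and> r n < r (Suc n)"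
  proof (rule dependent_nat_choice)
    show "\<exists>x. good x" using ex_good by blast
    show "\<exists>y. good y \<and> x < y" for x n using ex_good[of "Suc x"] by (auto simp: Suc_le_eq)
  qed
  then obtain r where r: "\<And>n. good (r n)" "\<And>n. r n < r (Suc n)" by blast
  then have "strict_mono r" by (simp add: strict_mono_Suc_iff)
  moreover have "incseq (\<lambda>i. s (r i))"
    using r unfolding good_def by (intro incseq_SucI) (simp add: less_imp_le)
  ultimately show ?thesis by blast
qed

text \<open>Coordinates are handled one at a time: a further subsequence makes the new coordinate
  monotone, and the coordinates treated before stay monotone along it.\<close>

lemma dickson:
  fixes g :: "nat \<Rightarrow> 'a \<Rightarrow> nat"
  assumes "finite A"
  shows "\<exists>r :: nat \<Rightarrow> nat. strict_mono r \<and> (\<forall>x\<in>A. incseq (\<lambda>i. g (r i) x))"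
  using assms
proof (induction A rule: finite_induct)
  case empty
  then show ?case by (auto intro: strict_mono_id)
next
  case (insert a A)
  then obtain r where r: "strict_mono r" "\<forall>x\<in>A. incseq (\<lambda>i. g (r i) x)" by blast
  obtain q :: "nat \<Rightarrow> nat" where q: "strict_mono q" "incseq (\<lambda>i. g (r (q i)) a)"
    using incseq_subseq_nat[of "\<lambda>i. g (r i) a"] by blast
  have "incseq (\<lambda>i. g (r (q i)) x)" if "x \<in> A" for x
    using r(2) that q(1) unfolding incseq_def by (meson strict_mono_less_eq)
  then show ?case
    using r(1) q by (intro exI[of _ "r \<circ> q"]) (auto simp: strict_mono_def)
qed

section \<open>Slicing up-closed sets of multiplicity functions\<close>

text \<open>Total functions vanishing off \<open>A\<close> instead of functions on \<open>A\<close>: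
  the pointwise order, equality and the update \<open>f(a := t)\<close> can then be used across
  different supports.\<close>

definition supported_on :: "'a set \<Rightarrow> ('a \<Rightarrow> nat) set" where
  "supported_on A = {f. \<forall>x. x \<notin> A \<longrightarrow> f x = 0}"

definition up_closed :: "('a \<Rightarrow> nat) set \<Rightarrow> bool" where
  "up_closed U \<longleftrightarrow> (\<forall>f g. f \<in> U \<longrightarrow> f \<le> g \<longrightarrow> g \<in> U)"

lemma up_closedD: "up_closed U \<Longrightarrow> f \<in> U \<Longrightarrow> f \<le> g \<Longrightarrow> g \<in> U"
  unfolding up_closed_def by blast

definition weight :: "'a set \<Rightarrow> ('a \<Rightarrow> nat) \<Rightarrow> ('a \<Rightarrow> nat) \<Rightarrow> nat" where
  "weight A w f = (\<Sum>x\<in>A. w x * f x)"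

lemma finite_supported_on_bounded:
  assumes "finite A"
  shows "finite {f \<in> supported_on A. \<forall>x\<in>A. f x \<le> n}"
proof -
  have "{f \<in> supported_on A. \<forall>x\<in>A. f x \<le> n}
      = {f. \<forall>x. (x \<in> A \<longrightarrow> f x \<in> {..n}) \<and> (x \<notin> A \<longrightarrow> f x = 0)}"
    by (auto simp: supported_on_def)
  then show ?thesis using finite_set_of_finite_funs[OF assms, of "{..n}" 0] by simp
qed

lemma finite_weight_eq:
  assumes "finite A" and "\<And>x. x \<in> A \<Longrightarrow> w x > 0"
  shows "finite {f \<in> supported_on A. weight A w f = n}"
proof (rule finite_subset[OF _ finite_supported_on_bounded[OF assms(1), of n]])
  have "f x \<le> weight A w f" if "x \<in> A" for f x
  proof -
    have "f x \<le> w x * f x" using assms(2)[OF that] by simp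
    also have "\<dots> \<le> weight A w f"
      unfolding weight_def using assms(1) that by (intro member_le_sum) auto
    finally show ?thesis .
  qed
  then show "{f \<in> supported_on A. weight A w f = n}
      \<subseteq> {f \<in> supported_on A. \<forall>x\<in>A. f x \<le> n}"
    by auto
qed

text \<open>The slices of an up-closed set along one coordinate increase with the height,
  so by Dickson's lemma they are eventually constant.\<close>

lemma slices_stabilise:
  assumes "finite A" and "a \<notin> A" and "up_closed U"
  shows "\<exists>T. \<forall>t\<ge>T. \<forall>f\<in>supported_on A. f(a := t) \<in> U \<longrightarrow> f(a := T) \<in> U"
proof (rule ccontr)
  assume "\<not> ?thesis"
  then have "\<forall>T. \<exists>t f. t \<ge> T \<and> f \<in> supported_on A \<and> f(a := t) \<in> U \<and> f(a := T) \<notin> U"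
    by blast
  then obtain t f where tf: "\<And>T. t T \<ge> T" "\<And>T. f T \<in> supported_on A"
    "\<And>T. (f T)(a := t T) \<in> U" "\<And>T. (f T)(a := T) \<notin> U"
    by metis
  obtain r :: "nat \<Rightarrow> nat" where r: "strict_mono r" "\<forall>x\<in>A. incseq (\<lambda>i. f (r i) x)"
    using dickson[OF assms(1)] by blast
  \<comment> \<open>Both indices lie on the subsequence, so \<open>f i\<close> is below
    \<open>f j\<close> on \<open>A\<close>, and \<open>j \<ge> t i\<close> since \<open>r\<close> is
    strictly increasing. The member of \<open>U\<close> obtained at \<open>i\<close> is therefore
    below the function excluded from \<open>U\<close> at \<open>j\<close>.\<close>
  define i where "i = r 0"
  define j where "j = r (t i)"
  have "f i x \<le> f j x" for x
  proof (cases "x \<in> A")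
    case True
    then show ?thesis using r(2) by (auto simp: i_def j_def incseq_def)
  next
    case False
    then show ?thesis using tf(2) by (simp add: supported_on_def)
  qed
  moreover have "t i \<le> j" unfolding j_def using r(1) by (rule strict_mono_imp_increasing)
  ultimately have "(f i)(a := t i) \<le> (f j)(a := j)" by (simp add: le_fun_def)
  then show False using up_closedD[OF assms(3) tf(3)] tf(4) by blast
qed

text \<open>The functions are split by their height at \<open>a\<close>. Below the stabilisation
  height \<open>T\<close> there are finitely many slices, each counted by induction with a delay.
  From \<open>T\<close> on all slices agree, so the tail satisfies a difference equation with step
  \<open>w a\<close>.\<close>

theorem eventually_qp_up_closed:
  fixes w :: "'a \<Rightarrow> nat"
  assumes "finite A" and "\<And>x. x \<in> A \<Longrightarrow> w x > 0" and "up_closed U"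
  shows "eventually_qp (\<lambda>n. real (card {f \<in> supported_on A. f \<in> U \<and> weight A w f = n}))"
  using assms
proof (induction A arbitrary: U rule: finite_induct)
  case empty
  \<comment> \<open>Only total \<open>0\<close> is attained over the empty set, so the count
    vanishes from \<open>1\<close> on.\<close>
  have "{f \<in> supported_on {}. f \<in> U \<and> weight {} w f = n} = {}" if "n \<ge> 1" for n
    using that by (auto simp: weight_def)
  then show ?case
    by (intro eventually_qp_cong[OF eventually_qp_const[of 0], of 1]) (simp only: card.empty)
next
  case (insert a A)
  let ?A = "insert a A"
  define S where "S t n = {f \<in> supported_on A. f \<in> {f. f(a := t) \<in> U} \<and> weight A w f = n}" for t n
  define E where "E B n = {f \<in> supported_on ?A. f \<in> U \<and> weight ?A w f = n \<and> f a \<in> B}" for B n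
  have wa: "w a > 0" using insert.prems by simp
  have wt: "weight ?A w f = w a * f a + weight A w f" for f
    using insert.hyps by (simp add: weight_def)
  have wt_upd: "weight A w (f(a := t)) = weight A w f" for f t
    unfolding weight_def using insert.hyps by (intro sum.cong) auto
  have finE: "finite (E B n)" for B n
    by (rule finite_subset[OF _ finite_weight_eq[of ?A w n]])
       (use insert in \<open>auto simp: E_def\<close>)
  have up: "up_closed {f. f(a := t) \<in> U}" for t
    unfolding up_closed_def
    using up_closedD[OF insert.prems(2)] by (auto simp: le_fun_def)
  have qpS: "eventually_qp (\<lambda>n. real (card (S t n)))" for t
    unfolding S_def using insert.IH[OF _ up] insert.prems by simp
  have cardE1: "card (E {t} n) = (if w a * t \<le> n then card (S t (n - w a * t)) else 0)" for t n
  proof (cases "w a * t \<le> n")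
    case True
    have "bij_betw (\<lambda>f. f(a := t)) (S t (n - w a * t)) (E {t} n)"
      by (rule bij_betw_byWitness[where f' = "\<lambda>f. f(a := 0)"])
         (use True insert.hyps in \<open>auto simp: S_def E_def supported_on_def wt wt_upd fun_eq_iff\<close>)
    then show ?thesis using True by (simp add: bij_betw_same_card)
  next
    case False
    then have "E {t} n = {}" by (auto simp: E_def wt)
    then show ?thesis using False by simp
  qed
  have qpE1: "eventually_qp (\<lambda>n. real (card (E {t} n)))" for t
    unfolding cardE1 using eventually_qp_delay[OF qpS[of t], of "w a * t"]
    by (simp add: if_distrib cong: if_cong)
  obtain T where T: "\<And>t f. t \<ge> T \<Longrightarrow> f \<in> supported_on A \<Longrightarrow> f(a := t) \<in> U \<Longrightarrow> f(a := T) \<in> U"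
    using slices_stabilise[OF insert.hyps insert.prems(2)] by blast
  \<comment> \<open>At heights from \<open>T\<close> on, membership in \<open>U\<close> does not
    depend on the height, so raising it by one can be undone. Lowering starts strictly above
    \<open>T\<close> and hence never leaves the stable range.\<close>
  have bij: "bij_betw (\<lambda>f. f(a := f a + 1)) (E {T..} n) (E {T<..} (n + w a))" for n
  proof (rule bij_betw_byWitness[where f' = "\<lambda>f. f(a := f a - 1)"])
    show "(\<lambda>f. f(a := f a + 1)) ` E {T..} n \<subseteq> E {T<..} (n + w a)"
    proof (intro image_subsetI)
      fix f assume f: "f \<in> E {T..} n"
      then have "f \<in> U" by (simp add: E_def)
      then have "f(a := f a + 1) \<in> U"
        by (rule up_closedD[OF insert.prems(2)]) (simp add: le_fun_def)
      then show "f(a := f a + 1) \<in> E {T<..} (n + w a)"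
        using f by (auto simp: E_def supported_on_def wt wt_upd)
    qed
    show "(\<lambda>f. f(a := f a - 1)) ` E {T<..} (n + w a) \<subseteq> E {T..} n"
    proof (intro image_subsetI)
      fix f assume f: "f \<in> E {T<..} (n + w a)"
      then have "f(a := 0) \<in> supported_on A" by (auto simp: E_def supported_on_def)
      moreover have "(f(a := 0))(a := f a) \<in> U" using f by (simp add: E_def)
      moreover have "f a \<ge> T" using f by (simp add: E_def)
      ultimately have "(f(a := 0))(a := T) \<in> U" using T by blast
      then have "f(a := T) \<in> U" by simp
      then have "f(a := f a - 1) \<in> U"
        by (rule up_closedD[OF insert.prems(2)]) (use f in \<open>auto simp: le_fun_def E_def\<close>)
      moreover obtain k where "f a = Suc k" using f by (cases "f a") (auto simp: E_def)
      ultimately show "f(a := f a - 1) \<in> E {T..} n"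
        using f by (auto simp: E_def supported_on_def wt wt_upd)
    qed
  qed (auto simp: E_def)
  have shift: "card (E {T<..} (n + w a)) = card (E {T..} n)" for n
    by (rule bij_betw_same_card[OF bij, symmetric])
  have split: "card (E {T..} n) = card (E {T} n) + card (E {T<..} n)" for n
  proof -
    have "E {T..} n = E {T} n \<union> E {T<..} n" by (auto simp: E_def)
    moreover have "E {T} n \<inter> E {T<..} n = {}" by (auto simp: E_def)
    ultimately show ?thesis by (simp add: card_Un_disjoint finE)
  qed
  \<comment> \<open>The tail at \<open>n + w a\<close> exceeds the tail at \<open>n\<close> by the
    slice of height exactly \<open>T\<close> at total \<open>n + w a\<close>; this slice is the
    inhomogeneous term of the difference equation.\<close>
  have "eventually_qp (\<lambda>n. real (card (E {T} (n + w a))))"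
    by (rule eventually_qp_shift[OF qpE1])
  then have tail: "eventually_qp (\<lambda>n. real (card (E {T..} n)))"
    by (rule eventually_qp_antidifference[OF _ wa]) (use split shift in simp)
  have "card {f \<in> supported_on ?A. f \<in> U \<and> weight ?A w f = n}
      = (\<Sum>t<T. card (E {t} n)) + card (E {T..} n)" for n
  proof -
    have "{f \<in> supported_on ?A. f \<in> U \<and> weight ?A w f = n} = (\<Union>t<T. E {t} n) \<union> E {T..} n"
      by (auto simp: E_def not_less)
    moreover have "(\<Union>t<T. E {t} n) \<inter> E {T..} n = {}" by (auto simp: E_def)
    moreover have "card (\<Union>t<T. E {t} n) = (\<Sum>t<T. card (E {t} n))"
      by (rule card_UN_disjoint) (auto simp: finE, auto simp: E_def)
    ultimately show ?thesis by (simp add: card_Un_disjoint finE)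
  qed
  then show ?case
    using eventually_qp_add[OF eventually_qp_sum[of "{..<T}", OF qpE1] tail] by simp
qed

text \<open>A function fixed by \<open>\<sigma>\<close> is a function on the set of \<open>\<sigma>\<close>-cycles, each of which
  contributes to the total with its cardinality. In the proof, \<open>\<kappa> x\<close> is the cycle of \<open>x\<close>, described
  as the set of points that no \<open>\<sigma>\<close>-invariant function separates from \<open>x\<close>.\<close>

lemma eventually_qp_fixed:
  assumes X: "finite X" and \<sigma>: "\<sigma> permutes X" and U: "up_closed U"
  shows "eventually_qp
    (\<lambda>n. real (card {f \<in> supported_on X. f \<circ> \<sigma> = f \<and> f \<in> U \<and> sum f X = n}))"
proof -
  define \<kappa> where "\<kappa> x = {y \<in> X. \<forall>f :: 'a \<Rightarrow> nat. f \<circ> \<sigma> = f \<longrightarrow> f y = f x}" for x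
  \<comment> \<open>The fibre of \<open>\<kappa>\<close> over a cycle is the cycle itself, so this
    is the cycle length, in the form produced by grouping a sum over \<open>X\<close> by
    \<open>\<kappa>\<close>.\<close>
  define w where "w B = card {x \<in> X. \<kappa> x = B}" for B
  define lift where "lift h x = (if x \<in> X then h (\<kappa> x) else 0 :: nat)" for h x
  let ?A = "\<kappa> ` X"
  have \<kappa>_\<sigma>: "\<kappa> (\<sigma> x) = \<kappa> x" for x
    unfolding \<kappa>_def by (metis (no_types, lifting) comp_apply)
  have \<kappa>_eq: "f y = f x" if "f \<circ> \<sigma> = f" "\<kappa> y = \<kappa> x" "y \<in> X" for f :: "'a \<Rightarrow> nat" and x y
  proof -
    have "y \<in> \<kappa> y" using that(3) by (simp add: \<kappa>_def)
    then have "y \<in> \<kappa> x" unfolding that(2) .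
    then show ?thesis using that(1) by (simp add: \<kappa>_def)
  qed
  have w: "w B > 0" if "B \<in> ?A" for B
    unfolding w_def using that X by (auto simp: card_gt_0_iff)
  have sum_lift: "sum (lift h) X = weight ?A w h" for h
  proof -
    have "sum (lift h) X = (\<Sum>x\<in>X. h (\<kappa> x))" by (simp add: lift_def)
    also have "\<dots> = (\<Sum>B\<in>?A. \<Sum>x\<in>{x \<in> X. \<kappa> x = B}. h (\<kappa> x))"
      by (rule sum.image_gen[OF X])
    also have "\<dots> = weight ?A w h" unfolding weight_def w_def by (intro sum.cong) auto
    finally show ?thesis .
  qed
  have bij: "bij_betw lift {h \<in> supported_on ?A. h \<in> {h. lift h \<in> U} \<and> weight ?A w h = n}
      {f \<in> supported_on X. f \<circ> \<sigma> = f \<and> f \<in> U \<and> sum f X = n}" for n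
    unfolding bij_betw_def
  proof
    show "inj_on lift {h \<in> supported_on ?A. h \<in> {h. lift h \<in> U} \<and> weight ?A w h = n}"
    proof (rule inj_onI, rule ext)
      fix h h' B
      assume hh': "h \<in> {h \<in> supported_on ?A. h \<in> {h. lift h \<in> U} \<and> weight ?A w h = n}"
        "h' \<in> {h \<in> supported_on ?A. h \<in> {h. lift h \<in> U} \<and> weight ?A w h = n}"
        and eq: "lift h = lift h'"
      show "h B = h' B"
      proof (cases "B \<in> ?A")
        case True
        then obtain x where "x \<in> X" "B = \<kappa> x" by blast
        then show ?thesis using fun_cong[OF eq, of x] by (simp add: lift_def)
      qed (use hh' in \<open>simp add: supported_on_def\<close>)
    qed
    show "lift ` {h \<in> supported_on ?A. h \<in> {h. lift h \<in> U} \<and> weight ?A w h = n}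
        = {f \<in> supported_on X. f \<circ> \<sigma> = f \<and> f \<in> U \<and> sum f X = n}"
    proof (intro Set.set_eqI iffI)
      fix f assume "f \<in> lift ` {h \<in> supported_on ?A. h \<in> {h. lift h \<in> U} \<and> weight ?A w h = n}"
      then obtain h where h: "f = lift h" "lift h \<in> U" "weight ?A w h = n" by auto
      have "lift h \<circ> \<sigma> = lift h"
        by (rule ext) (simp add: lift_def \<kappa>_\<sigma> permutes_in_image[OF \<sigma>])
      moreover have "lift h \<in> supported_on X" by (simp add: lift_def supported_on_def)
      ultimately show "f \<in> {f \<in> supported_on X. f \<circ> \<sigma> = f \<and> f \<in> U \<and> sum f X = n}"
        using h by (simp add: sum_lift)
    next
      fix f assume f: "f \<in> {f \<in> supported_on X. f \<circ> \<sigma> = f \<and> f \<in> U \<and> sum f X = n}"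
      \<comment> \<open>Any representative of the cycle gives the same value, since the invariant
        \<open>f\<close> is constant on it by \<open>\<kappa>_eq\<close>.\<close>
      define h where "h B = (if B \<in> ?A then f (SOME x. x \<in> X \<and> \<kappa> x = B) else 0)" for B
      have "h (\<kappa> x) = f x" if "x \<in> X" for x
      proof -
        have "\<exists>y. y \<in> X \<and> \<kappa> y = \<kappa> x" using that by blast
        then have "(SOME y. y \<in> X \<and> \<kappa> y = \<kappa> x) \<in> X \<and> \<kappa> (SOME y. y \<in> X \<and> \<kappa> y = \<kappa> x) = \<kappa> x"
          by (rule someI_ex)
        then have "f (SOME y. y \<in> X \<and> \<kappa> y = \<kappa> x) = f x"
          using f by (intro \<kappa>_eq) auto
        then show ?thesis using that by (simp add: h_def)
      qed
      moreover have "f x = 0" if "x \<notin> X" for x using f that by (simp add: supported_on_def)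
      ultimately have lift: "lift h = f" by (intro ext) (simp add: lift_def)
      moreover have "h \<in> supported_on ?A" by (simp add: h_def supported_on_def)
      ultimately have "h \<in> {h \<in> supported_on ?A. h \<in> {h. lift h \<in> U} \<and> weight ?A w h = n}"
        using f sum_lift[of h] by simp
      then show "f \<in> lift ` {h \<in> supported_on ?A. h \<in> {h. lift h \<in> U} \<and> weight ?A w h = n}"
        using lift by blast
    qed
  qed
  have "up_closed {h. lift h \<in> U}"
    unfolding up_closed_def
  proof (intro allI impI)
    fix f g assume "f \<in> {h. lift h \<in> U}" "f \<le> g"
    then have "lift f \<in> U" "lift f \<le> lift g" by (simp_all add: le_fun_def lift_def)
    then show "g \<in> {h. lift h \<in> U}" using up_closedD[OF U] by blast
  qed
  then have "eventually_qp (\<lambda>n. real (card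
      {h \<in> supported_on ?A. h \<in> {h. lift h \<in> U} \<and> weight ?A w h = n}))"
    using X w by (intro eventually_qp_up_closed) auto
  then show ?thesis using bij_betw_same_card[OF bij] by simp
qed

section \<open>Orbit counting\<close>

text \<open>Pairs with \<open>f \<circ> \<sigma> = f\<close> are counted in two ways. The fibres of
  \<open>\<Phi>\<close> on \<open>S\<close> are the orbits, so the size of its image is their
  number; this avoids a quotient and lets \<open>\<Phi>\<close> later be the isomorphism
  class.\<close>

lemma burnside_precomp:
  fixes S :: "('a \<Rightarrow> 'b) set"
  assumes S: "finite S" and G: "finite G" "G \<noteq> {}"
    and perm: "\<And>\<sigma>. \<sigma> \<in> G \<Longrightarrow> \<sigma> permutes X"
    and comp: "\<And>\<sigma> \<tau>. \<sigma> \<in> G \<Longrightarrow> \<tau> \<in> G \<Longrightarrow> \<sigma> \<circ> \<tau> \<in> G"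
    and inv: "\<And>\<sigma>. \<sigma> \<in> G \<Longrightarrow> inv_into UNIV \<sigma> \<in> G"
    and closed: "\<And>f \<sigma>. f \<in> S \<Longrightarrow> \<sigma> \<in> G \<Longrightarrow> f \<circ> \<sigma> \<in> S"
    and \<Phi>: "\<And>f g. f \<in> S \<Longrightarrow> g \<in> S \<Longrightarrow> \<Phi> f = \<Phi> g \<longleftrightarrow> (\<exists>\<sigma>\<in>G. g = f \<circ> \<sigma>)"
  shows "card G * card (\<Phi> ` S) = (\<Sum>\<sigma>\<in>G. card {f \<in> S. f \<circ> \<sigma> = f})"
proof -
  \<comment> \<open>The elements carrying \<open>f\<close> to \<open>g\<close> form the left coset
    of the stabiliser of \<open>g\<close> by \<open>\<rho>\<close>.\<close>
  have coset: "card {\<sigma> \<in> G. f \<circ> \<sigma> = g} = card {\<sigma> \<in> G. g \<circ> \<sigma> = g}"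
    if "\<rho> \<in> G" "g = f \<circ> \<rho>" for f g \<rho>
  proof (rule bij_betw_same_card[of "(\<circ>) (inv_into UNIV \<rho>)"],
      rule bij_betw_byWitness[where f' = "(\<circ>) \<rho>"])
    have \<rho>: "\<rho> \<circ> inv_into UNIV \<rho> = id" "inv_into UNIV \<rho> \<circ> \<rho> = id"
      using perm[OF that(1)] by (simp_all add: permutes_inv_o)
    have "\<rho> \<circ> (inv_into UNIV \<rho> \<circ> \<sigma>) = \<sigma>" "inv_into UNIV \<rho> \<circ> (\<rho> \<circ> \<sigma>) = \<sigma>" for \<sigma>
      using \<rho>(1) \<rho>(2) by (metis o_assoc id_comp)+
    then show "\<forall>\<sigma>\<in>{\<sigma> \<in> G. f \<circ> \<sigma> = g}. \<rho> \<circ> (inv_into UNIV \<rho> \<circ> \<sigma>) = \<sigma>"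
      "\<forall>\<sigma>\<in>{\<sigma> \<in> G. g \<circ> \<sigma> = g}. inv_into UNIV \<rho> \<circ> (\<rho> \<circ> \<sigma>) = \<sigma>"
      by blast+
    show "(\<circ>) (inv_into UNIV \<rho>) ` {\<sigma> \<in> G. f \<circ> \<sigma> = g} \<subseteq> {\<sigma> \<in> G. g \<circ> \<sigma> = g}"
    proof (intro image_subsetI CollectI conjI)
      fix \<sigma> assume \<sigma>: "\<sigma> \<in> {\<sigma> \<in> G. f \<circ> \<sigma> = g}"
      then show "inv_into UNIV \<rho> \<circ> \<sigma> \<in> G" using that inv comp by simp
      have "g \<circ> (inv_into UNIV \<rho> \<circ> \<sigma>) = f \<circ> (\<rho> \<circ> inv_into UNIV \<rho>) \<circ> \<sigma>" unfolding that(2) by (simp only: o_assoc)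
      then show "g \<circ> (inv_into UNIV \<rho> \<circ> \<sigma>) = g" using \<sigma> \<rho> by simp
    qed
    show "(\<circ>) \<rho> ` {\<sigma> \<in> G. g \<circ> \<sigma> = g} \<subseteq> {\<sigma> \<in> G. f \<circ> \<sigma> = g}"
      using that comp by (auto simp: o_assoc)
  qed
  \<comment> \<open>Along one orbit each stabiliser is replaced by the equally large set of elements
    carrying a fixed \<open>f\<close> to \<open>g\<close>; these sets partition
    \<open>G\<close>.\<close>
  have stab: "(\<Sum>g\<in>{g \<in> S. \<Phi> g = b}. card {\<sigma> \<in> G. g \<circ> \<sigma> = g}) = card G"
    if "b \<in> \<Phi> ` S" for b
  proof -
    from that obtain f where f: "f \<in> S" "b = \<Phi> f" by blast
    have "(\<Sum>g\<in>{g \<in> S. \<Phi> g = b}. card {\<sigma> \<in> G. g \<circ> \<sigma> = g})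
        = (\<Sum>g\<in>{g \<in> S. \<Phi> g = b}. card {\<sigma> \<in> G. f \<circ> \<sigma> = g})"
    proof (rule sum.cong)
      fix g assume "g \<in> {g \<in> S. \<Phi> g = b}"
      then obtain \<rho> where "\<rho> \<in> G" "g = f \<circ> \<rho>" using \<Phi>[of f g] f by auto
      then show "card {\<sigma> \<in> G. g \<circ> \<sigma> = g} = card {\<sigma> \<in> G. f \<circ> \<sigma> = g}"
        by (simp only: coset)
    qed simp
    also have "\<dots> = card (\<Union>g\<in>{g \<in> S. \<Phi> g = b}. {\<sigma> \<in> G. f \<circ> \<sigma> = g})"
      by (rule card_UN_disjoint[symmetric]) (use S G in auto)
    also have "(\<Union>g\<in>{g \<in> S. \<Phi> g = b}. {\<sigma> \<in> G. f \<circ> \<sigma> = g}) = G"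
      using closed[OF f(1)] \<Phi>[OF f(1)] f(2) by fastforce
    finally show ?thesis .
  qed
  have "(\<Sum>\<sigma>\<in>G. card {f \<in> S. f \<circ> \<sigma> = f}) = (\<Sum>f\<in>S. card {\<sigma> \<in> G. f \<circ> \<sigma> = f})"
    using sum.swap_restrict[OF G(1) S, of "\<lambda>_ _. 1 :: nat" "\<lambda>\<sigma> f. f \<circ> \<sigma> = f"] by simp
  also have "\<dots> = (\<Sum>b\<in>\<Phi> ` S. \<Sum>f\<in>{f \<in> S. \<Phi> f = b}. card {\<sigma> \<in> G. f \<circ> \<sigma> = f})"
    by (rule sum.image_gen[OF S])
  also have "\<dots> = card G * card (\<Phi> ` S)" using stab by simp
  finally show ?thesis by simp
qed

text \<open>For each \<open>\<sigma>\<close> the fixed functions in \<open>U - V\<close> are counted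
  as those in \<open>U\<close> minus those in \<open>V\<close>. Stability under \<open>G\<close> is
  asked of the difference only, and \<open>\<Phi>\<close> is compared only at equal totals because
  Burnside's lemma is applied for one \<open>n\<close> at a time.\<close>

theorem eventually_qp_orbits:
  assumes X: "finite X" and G: "G \<noteq> {}"
    and perm: "\<And>\<sigma>. \<sigma> \<in> G \<Longrightarrow> \<sigma> permutes X"
    and comp: "\<And>\<sigma> \<tau>. \<sigma> \<in> G \<Longrightarrow> \<tau> \<in> G \<Longrightarrow> \<sigma> \<circ> \<tau> \<in> G"
    and inv: "\<And>\<sigma>. \<sigma> \<in> G \<Longrightarrow> inv_into UNIV \<sigma> \<in> G"
    and U: "up_closed U" and V: "up_closed V" and VU: "V \<subseteq> U"
    and closed: "\<And>f \<sigma>. f \<in> supported_on X \<Longrightarrow> f \<in> U - V \<Longrightarrow> \<sigma> \<in> G \<Longrightarrow> f \<circ> \<sigma> \<in> U - V"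
    and \<Phi>: "\<And>f g. f \<in> supported_on X \<Longrightarrow> g \<in> supported_on X \<Longrightarrow> f \<in> U - V \<Longrightarrow> g \<in> U - V
        \<Longrightarrow> sum f X = sum g X \<Longrightarrow> \<Phi> f = \<Phi> g \<longleftrightarrow> (\<exists>\<sigma>\<in>G. g = f \<circ> \<sigma>)"
  shows "eventually_qp
    (\<lambda>n. real (card (\<Phi> ` {f \<in> supported_on X. f \<in> U - V \<and> sum f X = n})))"
proof -
  have fin: "finite {f \<in> supported_on X. sum f X = n}" for n
    using finite_weight_eq[OF X, of "\<lambda>_. 1" n] by (simp add: weight_def)
  have finG: "finite G"
    by (rule finite_subset[OF _ finite_permutations[OF X]]) (use perm in auto)
  define F where "F W \<sigma> n = card {f \<in> supported_on X. f \<circ> \<sigma> = f \<and> f \<in> W \<and> sum f X = n}" for W \<sigma> n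
  have "real (card G) * real (card (\<Phi> ` {f \<in> supported_on X. f \<in> U - V \<and> sum f X = n}))
      = (\<Sum>\<sigma>\<in>G. real (F U \<sigma> n) - real (F V \<sigma> n))" for n
  proof -
    let ?S = "{f \<in> supported_on X. f \<in> U - V \<and> sum f X = n}"
    have "card G * card (\<Phi> ` ?S) = (\<Sum>\<sigma>\<in>G. card {f \<in> ?S. f \<circ> \<sigma> = f})"
    proof (rule burnside_precomp[OF _ finG G perm comp inv])
      show "finite ?S" by (rule finite_subset[OF _ fin[of n]]) auto
      show "f \<circ> \<sigma> \<in> ?S" if "f \<in> ?S" "\<sigma> \<in> G" for f \<sigma>
      proof -
        have "sum (f \<circ> \<sigma>) X = sum f X"
          using sum.permute[OF perm[OF that(2)], of f] by (simp add: o_def)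
        moreover have "f \<circ> \<sigma> \<in> supported_on X"
          using that permutes_not_in[OF perm[OF that(2)]] by (simp add: supported_on_def)
        ultimately show ?thesis using that closed by simp
      qed
    qed (use \<Phi> in auto)
    moreover have "real (card {f \<in> ?S. f \<circ> \<sigma> = f}) = real (F U \<sigma> n) - real (F V \<sigma> n)" for \<sigma>
    proof -
      have "{f \<in> ?S. f \<circ> \<sigma> = f}
          = {f \<in> supported_on X. f \<circ> \<sigma> = f \<and> f \<in> U \<and> sum f X = n}
            - {f \<in> supported_on X. f \<circ> \<sigma> = f \<and> f \<in> V \<and> sum f X = n}"
        by auto
      moreover have "finite {f \<in> supported_on X. f \<circ> \<sigma> = f \<and> f \<in> U \<and> sum f X = n}"
        by (rule finite_subset[OF _ fin[of n]]) auto
      moreover have "{f \<in> supported_on X. f \<circ> \<sigma> = f \<and> f \<in> V \<and> sum f X = n}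
          \<subseteq> {f \<in> supported_on X. f \<circ> \<sigma> = f \<and> f \<in> U \<and> sum f X = n}"
        using VU by auto
      ultimately show ?thesis
        unfolding F_def by (simp add: card_Diff_subset finite_subset card_mono of_nat_diff)
    qed
    ultimately show ?thesis by (metis (mono_tags, lifting) of_nat_mult of_nat_sum sum.cong)
  qed
  moreover have "real (card G) \<noteq> 0" using finG G by simp
  ultimately have eq: "real (card (\<Phi> ` {f \<in> supported_on X. f \<in> U - V \<and> sum f X = n}))
      = 1 / real (card G) * (\<Sum>\<sigma>\<in>G. real (F U \<sigma> n) - real (F V \<sigma> n))" for n
    by (simp add: field_simps)
  have "eventually_qp (\<lambda>n. real (F W \<sigma> n))" if "\<sigma> \<in> G" "up_closed W" for W \<sigma>
    unfolding F_def using eventually_qp_fixed[OF X perm[OF that(1)] that(2)] .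
  then show ?thesis
    unfolding eq using U V
    by (intro eventually_qp_cmult eventually_qp_sum eventually_qp_diff) auto
qed

section \<open>Generator matrices of linear codes\<close>

text \<open>The columns of an \<open>m\<close> by \<open>n\<close> generator matrix. Values from
  \<open>n\<close> on are arbitrary, hence the congruence rules below.\<close>

definition columns :: "nat \<Rightarrow> nat \<Rightarrow> (nat \<Rightarrow> 'k vec) \<Rightarrow> bool" where
  "columns m n c \<longleftrightarrow> (\<forall>i<n. c i \<in> carrier_vec m)"

definition word :: "nat \<Rightarrow> (nat \<Rightarrow> 'k::field vec) \<Rightarrow> 'k vec \<Rightarrow> 'k vec" where
  "word n c x = vec n (\<lambda>i. x \<bullet> c i)"

definition code_of :: "nat \<Rightarrow> nat \<Rightarrow> (nat \<Rightarrow> 'k::field vec) \<Rightarrow> 'k vec set" where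
  "code_of m n c = word n c ` carrier_vec m"

text \<open>Rank \<open>m\<close> in dual form: no nonzero functional vanishes on all columns. This
  is the triviality of the kernel of \<open>word n c\<close>.\<close>

definition spanning :: "nat \<Rightarrow> nat \<Rightarrow> (nat \<Rightarrow> 'k::field vec) \<Rightarrow> bool" where
  "spanning m n c \<longleftrightarrow> (\<forall>x\<in>carrier_vec m. (\<forall>i<n. x \<bullet> c i = 0) \<longrightarrow> x = 0\<^sub>v m)"

lemma columnsD: "columns m n c \<Longrightarrow> i < n \<Longrightarrow> c i \<in> carrier_vec m"
  by (simp add: columns_def)

lemma word_carrier [simp]: "word n c x \<in> carrier_vec n"
  by (simp add: word_def)

lemma word_index [simp]: "i < n \<Longrightarrow> word n c x $ i = x \<bullet> c i"
  by (simp add: word_def)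

lemma word_cong: "(\<And>i. i < n \<Longrightarrow> c i = d i) \<Longrightarrow> word n c x = word n d x"
  by (intro eq_vecI) (auto simp: word_def)

lemma code_of_cong: "(\<And>i. i < n \<Longrightarrow> c i = d i) \<Longrightarrow> code_of m n c = code_of m n d"
  by (simp add: code_of_def cong: word_cong)

lemma word_eq_iff: "word n c x = word n d y \<longleftrightarrow> (\<forall>i<n. x \<bullet> c i = y \<bullet> d i)"
  by (auto simp: word_def vec_eq_iff)

lemma word_add:
  assumes "columns m n c" and "x \<in> carrier_vec m" and "y \<in> carrier_vec m"
  shows "word n c (x + y) = word n c x + word n c y"
  using assms by (intro eq_vecI) (auto simp: word_def columnsD add_scalar_prod_distrib)

lemma word_smult:
  assumes "columns m n c" and "x \<in> carrier_vec m"
  shows "word n c (a \<cdot>\<^sub>v x) = a \<cdot>\<^sub>v word n c x"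
  using assms by (intro eq_vecI) (auto simp: word_def columnsD)

lemma inj_on_word_iff:
  fixes c :: "nat \<Rightarrow> 'k::field vec"
  assumes c: "columns m n c"
  shows "inj_on (word n c) (carrier_vec m) \<longleftrightarrow> spanning m n c"
proof
  assume inj: "inj_on (word n c) (carrier_vec m)"
  show "spanning m n c"
    unfolding spanning_def
  proof (intro ballI impI)
    fix x :: "'k vec" assume x: "x \<in> carrier_vec m" "\<forall>i<n. x \<bullet> c i = 0"
    then have "word n c x = word n c (0\<^sub>v m)"
      unfolding word_eq_iff using c by (simp add: columnsD)
    then show "x = 0\<^sub>v m" using inj x by (simp add: inj_on_def)
  qed
next
  assume sp: "spanning m n c"
  show "inj_on (word n c) (carrier_vec m)"
  proof (rule inj_onI)
    fix x y :: "'k vec"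
    assume xy: "x \<in> carrier_vec m" "y \<in> carrier_vec m" "word n c x = word n c y"
    have "(x - y) \<bullet> c i = 0" if "i < n" for i
      using xy that columnsD[OF c that] by (simp add: word_eq_iff minus_scalar_prod_distrib)
    then have "x - y = 0\<^sub>v m" using sp xy unfolding spanning_def by simp
    then have "x $ i - y $ i = 0" if "i < m" for i
      using xy that by (metis carrier_vecD index_minus_vec(1) index_zero_vec(1))
    then show "x = y" using xy by (intro eq_vecI) auto
  qed
qed

lemma finite_carrier_vec: "finite (carrier_vec m :: 'k::finite vec set)"
  and card_carrier_vec: "card (carrier_vec m :: 'k::finite vec set) = CARD('k) ^ m"
proof -
  have bij: "bij_betw (vec m) ({..<m} \<rightarrow>\<^sub>E UNIV) (carrier_vec m :: 'k vec set)"
    by (rule bij_betw_byWitness[where f' = "\<lambda>v. \<lambda>i\<in>{..<m}. v $ i"])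
       (auto simp: fun_eq_iff PiE_def extensional_def)
  show "finite (carrier_vec m :: 'k vec set)"
    using bij_betw_finite[OF bij] by (simp add: finite_PiE)
  show "card (carrier_vec m :: 'k vec set) = CARD('k) ^ m"
    using bij_betw_same_card[OF bij] by (simp add: card_PiE)
qed

text \<open>A map on a set of \<open>q ^ m\<close> elements is injective exactly when its image has
  that size. Spanning thus becomes a property of the code, and it passes to other matrices with the
  same code and through bijections of words.\<close>

lemma spanning_iff_card:
  fixes c :: "nat \<Rightarrow> 'k::{field,finite} vec"
  assumes c: "columns m n c"
  shows "spanning m n c \<longleftrightarrow> card (code_of m n c) = CARD('k) ^ m"
  unfolding inj_on_word_iff[OF c, symmetric] code_of_def
  using card_carrier_vec[of m, where 'k = 'k] finite_carrier_vec[of m, where 'k = 'k]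
  by (metis card_image eq_card_imp_inj_on)

text \<open>A basis of the code supplies the rows, so \<open>word n c x\<close> is the combination
  of the basis with coefficients \<open>x\<close>. Existence of coordinates gives the row space,
  uniqueness gives injectivity.\<close>

lemma linear_code_columns:
  fixes C :: "'k::{field,finite} vec set"
  assumes "linear_code m n C"
  obtains c where "columns m n c" and "spanning m n c" and "C = code_of m n c"
proof -
  interpret vec_space "TYPE('k)" n .
  have sub: "subspace class_ring C V" and dim: "code_dim n C = m"
    using assms by (auto simp: linear_code_def)
  interpret W: vectorspace class_ring "V\<lparr>carrier := C\<rparr>"
    by (rule subspace_is_vs[OF sub])
  have submod: "submodule class_ring C V" using sub by (simp add: subspace_def)
  have Cn: "C \<subseteq> carrier_vec n" using submodule.subset[OF submod] by simp
  then have finC: "finite C" using finite_carrier_vec finite_subset by blast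
  have "W.fin_dim"
    unfolding W.fin_dim_def
    using finC W.span_is_subset2 W.in_own_span by (intro exI[of _ C]) auto
  then obtain B where B: "finite B" "W.basis B" using W.finite_basis_exists by blast
  then have cardB: "card B = m" using W.dim_basis dim by (simp add: code_dim_def)
  have BC: "B \<subseteq> C" using B(2) by (simp add: W.basis_def)
  then have Bn: "B \<subseteq> carrier_vec n" using Cn by blast
  have ex1: "\<exists>!a. a \<in> B \<rightarrow>\<^sub>E UNIV \<and> lincomb a B = v" if "v \<in> C" for v
  proof -
    have "\<exists>!a. a \<in> B \<rightarrow>\<^sub>E UNIV \<and> W.lincomb a B = v"
      using W.basis_criterion[OF B(1)] B(2) BC that by simp
    moreover have "W.lincomb a B = lincomb a B" for a
      using lincomb_not_depend[OF B(1) BC submod, of a] by simp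
    ultimately show ?thesis by simp
  qed
  have closed: "lincomb a B \<in> C" for a
  proof -
    have "W.lincomb a B \<in> C" using W.lincomb_closed[of B a] BC by simp
    then show ?thesis using lincomb_not_depend[OF B(1) BC submod, of a] by simp
  qed
  obtain h where h: "bij_betw h {0..<m} B" using ex_bij_betw_nat_finite[OF B(1)] cardB by blast
  define h' where "h' = inv_into {0..<m} h"
  have h'h: "h' (h j) = j" if "j < m" for j
    using h that by (simp add: h'_def bij_betw_def)
  have h'B: "h' v < m" "h (h' v) = v" if "v \<in> B" for v
    using h that by (auto simp: h'_def bij_betw_def f_inv_into_f dest: inv_into_into)
  define c where "c i = vec m (\<lambda>j. h j $ i)" for i
  \<comment> \<open>Restricted to \<open>B\<close>, because the basis criterion states uniqueness of
    coefficients among extensional functions.\<close>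
  define co where "co x = (\<lambda>v\<in>B. x $ h' v)" for x :: "'k vec"
  have lc: "lincomb (co x) B = word n c x" if "x \<in> carrier_vec m" for x
  proof (rule eq_vecI)
    fix i assume "i < dim_vec (word n c x)"
    then have i: "i < n" by (simp add: word_def)
    have "lincomb (co x) B $ i = (\<Sum>v\<in>B. co x v * v $ i)"
      by (rule lincomb_index[OF i Bn])
    also have "\<dots> = (\<Sum>v\<in>B. x $ h' v * v $ i)" by (simp add: co_def)
    also have "\<dots> = (\<Sum>j\<in>{0..<m}. x $ h' (h j) * h j $ i)"
      by (rule sum.reindex_bij_betw[OF h, symmetric])
    also have "\<dots> = x \<bullet> c i" by (simp add: scalar_prod_def c_def h'h)
    finally show "lincomb (co x) B $ i = word n c x $ i" using i by simp
  qed (use lincomb_dim[OF B(1) Bn] in \<open>simp add: word_def\<close>)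
  have co: "co x \<in> B \<rightarrow>\<^sub>E UNIV" for x by (auto simp: co_def)
  have "inj_on (word n c) (carrier_vec m)"
  proof (rule inj_onI)
    fix x y :: "'k vec"
    assume xy: "x \<in> carrier_vec m" "y \<in> carrier_vec m" "word n c x = word n c y"
    then have "lincomb (co x) B = lincomb (co y) B" by (simp add: lc)
    then have "co x = co y" using ex1[OF closed[of "co x"]] co by metis
    have "x $ j = y $ j" if "j < m" for j
    proof -
      have "h j \<in> B" using bij_betw_apply[OF h] that by simp
      moreover have "co x (h j) = co y (h j)" using \<open>co x = co y\<close> by simp
      ultimately show ?thesis using that by (simp add: co_def h'h)
    qed
    then show "x = y" using xy by (intro eq_vecI) auto
  qed
  moreover have cols: "columns m n c" by (simp add: columns_def c_def)
  moreover have "C = code_of m n c"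
  proof
    show "code_of m n c \<subseteq> C" unfolding code_of_def using closed lc by (metis image_subsetI)
    show "C \<subseteq> code_of m n c"
    proof
      fix v assume "v \<in> C"
      then obtain a where a: "a \<in> B \<rightarrow>\<^sub>E UNIV" "lincomb a B = v" using ex1 by blast
      define x where "x = vec m (\<lambda>j. a (h j))"
      have "co x = a"
      proof
        fix v show "co x v = a v"
          using PiE_arb[OF a(1), of v] by (cases "v \<in> B") (simp_all add: co_def x_def h'B)
      qed
      then have "v = word n c x" using a(2) lc[of x] by (simp add: x_def)
      then show "v \<in> code_of m n c" by (auto simp: code_of_def x_def)
    qed
  qed
  ultimately show ?thesis using that inj_on_word_iff[OF cols] by blast
qed

text \<open>No basis is exhibited. The code has some dimension \<open>d\<close>, hence a generator
  matrix with \<open>d\<close> rows, and comparing the sizes \<open>q ^ d\<close> and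
  \<open>q ^ m\<close> forces \<open>d = m\<close>.\<close>

lemma linear_code_code_of:
  fixes c :: "nat \<Rightarrow> 'k::{field,finite} vec"
  assumes c: "columns m n c" and sp: "spanning m n c"
  shows "linear_code m n (code_of m n c)"
proof -
  interpret vec_space "TYPE('k)" n .
  have "submodule class_ring (code_of m n c) V"
  proof (unfold_locales, simp_all)
    show "code_of m n c \<subseteq> carrier_vec n" by (auto simp: code_of_def)
    fix v w assume "v \<in> code_of m n c" "w \<in> code_of m n c"
    then obtain x y where "x \<in> carrier_vec m" "v = word n c x" "y \<in> carrier_vec m" "w = word n c y"
      unfolding code_of_def by blast
    then have "v + w = word n c (x + y)" "x + y \<in> carrier_vec m" by (simp_all add: word_add[OF c])
    then show "v + w \<in> code_of m n c" unfolding code_of_def by blast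
  next
    have "word n c (0\<^sub>v m) = 0\<^sub>v n"
      by (intro eq_vecI) (auto simp: word_def columnsD[OF c])
    then show "0\<^sub>v n \<in> code_of m n c" unfolding code_of_def by (intro image_eqI[of _ _ "0\<^sub>v m"]) auto
  next
    fix a v assume "v \<in> code_of m n c"
    then obtain x where "x \<in> carrier_vec m" "v = word n c x"
      unfolding code_of_def by blast
    then have "a \<cdot>\<^sub>v v = word n c (a \<cdot>\<^sub>v x)" "a \<cdot>\<^sub>v x \<in> carrier_vec m"
      by (simp_all add: word_smult[OF c])
    then show "a \<cdot>\<^sub>v v \<in> code_of m n c" unfolding code_of_def by blast
  qed
  then have sub: "subspace class_ring (code_of m n c) V"
    by (simp add: subspace_def vec_vs)
  define d where "d = code_dim n (code_of m n c)"
  have "linear_code d n (code_of m n c)" using sub by (simp add: linear_code_def d_def)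
  then obtain c' where "columns d n c'" "spanning d n c'" "code_of m n c = code_of d n c'"
    by (rule linear_code_columns)
  then have "CARD('k) ^ d = CARD('k) ^ m" using spanning_iff_card c sp by metis
  moreover have "CARD('k) > 1"
    using card_mono[of UNIV "{0, 1 :: 'k}"] by simp
  ultimately have "d = m" using power_inject_exp by blast
  then show ?thesis using sub by (simp add: linear_code_def d_def)
qed

section \<open>Semilinear maps and isomorphism of codes\<close>

abbreviation field_aut :: "('k::field \<Rightarrow> 'k) \<Rightarrow> bool" where
  "field_aut \<tau> \<equiv> \<tau> \<in> ring_iso class_ring class_ring"

lemma field_aut_iff:
  "field_aut \<tau> \<longleftrightarrow> bij \<tau> \<and> \<tau> 1 = 1 \<and> (\<forall>x y. \<tau> (x + y) = \<tau> x + \<tau> y) \<and> (\<forall>x y. \<tau> (x * y) = \<tau> x * \<tau> y)"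
  by (auto simp: ring_iso_def Ring.ring_hom_def)

lemma field_aut_add: "field_aut \<tau> \<Longrightarrow> \<tau> (x + y) = \<tau> x + \<tau> y"
  and field_aut_mult: "field_aut \<tau> \<Longrightarrow> \<tau> (x * y) = \<tau> x * \<tau> y"
  and field_aut_1: "field_aut \<tau> \<Longrightarrow> \<tau> 1 = 1"
  and field_aut_bij: "field_aut \<tau> \<Longrightarrow> bij \<tau>"
  by (simp_all add: field_aut_iff)

lemma field_aut_0: "field_aut \<tau> \<Longrightarrow> \<tau> 0 = 0"
  using field_aut_add[of \<tau> 0 0] by (metis add_cancel_right_right add_0)

lemma field_aut_eq_0_iff: "field_aut \<tau> \<Longrightarrow> \<tau> x = 0 \<longleftrightarrow> x = 0"
  using field_aut_0 field_aut_bij by (metis bij_def injD)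

lemma field_aut_sum: "field_aut \<tau> \<Longrightarrow> \<tau> (sum f A) = (\<Sum>x\<in>A. \<tau> (f x))"
  by (induction A rule: infinite_finite_induct) (simp_all add: field_aut_0 field_aut_add)

lemma field_aut_id: "field_aut (\<lambda>x. x)"
  by (simp add: field_aut_iff bij_def)

lemma field_aut_comp: "field_aut \<tau> \<Longrightarrow> field_aut \<tau>' \<Longrightarrow> field_aut (\<tau> \<circ> \<tau>')"
  by (simp add: field_aut_iff bij_comp)

lemma field_aut_inv_cancel:
  assumes "field_aut \<tau>"
  shows "inv_into UNIV \<tau> (\<tau> x) = x" and "\<tau> (inv_into UNIV \<tau> x) = x"
  using field_aut_bij[OF assms] by (simp_all add: bij_is_inj bij_is_surj surj_f_inv_f)

lemma field_aut_inv:
  assumes "field_aut \<tau>"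
  shows "field_aut (inv_into UNIV \<tau>)"
  unfolding field_aut_iff
proof (intro conjI allI)
  show "bij (inv_into UNIV \<tau>)" using field_aut_bij[OF assms] by (rule bij_imp_bij_inv)
  note c = field_aut_inv_cancel[OF assms]
  show "inv_into UNIV \<tau> 1 = 1" using c(1)[of 1] by (simp add: field_aut_1[OF assms])
  fix x y
  show "inv_into UNIV \<tau> (x + y) = inv_into UNIV \<tau> x + inv_into UNIV \<tau> y"
    using c(1)[of "inv_into UNIV \<tau> x + inv_into UNIV \<tau> y"]
    by (simp add: field_aut_add[OF assms] c(2))
  show "inv_into UNIV \<tau> (x * y) = inv_into UNIV \<tau> x * inv_into UNIV \<tau> y"
    using c(1)[of "inv_into UNIV \<tau> x * inv_into UNIV \<tau> y"]
    by (simp add: field_aut_mult[OF assms] c(2))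
qed

lemma field_aut_scalar_prod:
  assumes "field_aut \<tau>" and "x \<in> carrier_vec m" and "y \<in> carrier_vec m"
  shows "\<tau> (x \<bullet> y) = map_vec \<tau> x \<bullet> map_vec \<tau> y"
  using assms by (simp add: scalar_prod_def field_aut_sum field_aut_mult)

text \<open>The elements of the general semilinear group of the column space, with their field
  automorphism as a parameter. Nothing is demanded outside \<open>carrier_vec m\<close>.\<close>

definition semilinear :: "nat \<Rightarrow> ('k::field \<Rightarrow> 'k) \<Rightarrow> ('k vec \<Rightarrow> 'k vec) \<Rightarrow> bool" where
  "semilinear m \<tau> g \<longleftrightarrow> field_aut \<tau> \<and> bij_betw g (carrier_vec m) (carrier_vec m) \<and>
     (\<forall>x\<in>carrier_vec m. \<forall>y\<in>carrier_vec m. g (x + y) = g x + g y) \<and>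
     (\<forall>a. \<forall>x\<in>carrier_vec m. g (a \<cdot>\<^sub>v x) = \<tau> a \<cdot>\<^sub>v g x)"

lemma semilinearD:
  assumes "semilinear m \<tau> g"
  shows "field_aut \<tau>" and "bij_betw g (carrier_vec m) (carrier_vec m)"
    and "x \<in> carrier_vec m \<Longrightarrow> g x \<in> carrier_vec m"
    and "x \<in> carrier_vec m \<Longrightarrow> y \<in> carrier_vec m \<Longrightarrow> g (x + y) = g x + g y"
    and "x \<in> carrier_vec m \<Longrightarrow> g (a \<cdot>\<^sub>v x) = \<tau> a \<cdot>\<^sub>v g x"
  using assms by (auto simp: semilinear_def bij_betw_apply)

lemma semilinear_comp:
  assumes f: "semilinear m \<tau> f" and g: "semilinear m \<tau>' g"
  shows "semilinear m (\<tau> \<circ> \<tau>') (f \<circ> g)"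
  unfolding semilinear_def
  using field_aut_comp[OF semilinearD(1)[OF f] semilinearD(1)[OF g]]
    bij_betw_trans[OF semilinearD(2)[OF g] semilinearD(2)[OF f]]
  by (simp add: semilinearD[OF f] semilinearD[OF g])

lemma semilinear_inv:
  assumes g: "semilinear m \<tau> g"
  shows "semilinear m (inv_into UNIV \<tau>) (inv_into (carrier_vec m) g)"
proof -
  let ?h = "inv_into (carrier_vec m) g"
  note bij = semilinearD(2)[OF g]
  have bij': "bij_betw ?h (carrier_vec m) (carrier_vec m)" by (rule bij_betw_inv_into[OF bij])
  have hg: "?h (g x) = x" if "x \<in> carrier_vec m" for x
    by (rule bij_betw_inv_into_left[OF bij that])
  have gh: "g (?h x) = x" if "x \<in> carrier_vec m" for x
    by (rule bij_betw_inv_into_right[OF bij that])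
  have h: "?h x \<in> carrier_vec m" if "x \<in> carrier_vec m" for x
    using bij_betw_apply[OF bij' that] .
  have "?h (x + y) = ?h x + ?h y" if "x \<in> carrier_vec m" "y \<in> carrier_vec m" for x y
    using hg[of "?h x + ?h y"] that by (simp add: semilinearD(4)[OF g] h gh)
  moreover have "?h (a \<cdot>\<^sub>v x) = inv_into UNIV \<tau> a \<cdot>\<^sub>v ?h x" if "x \<in> carrier_vec m" for a x
    using hg[of "inv_into UNIV \<tau> a \<cdot>\<^sub>v ?h x"] that
    by (simp add: semilinearD(5)[OF g] h gh field_aut_inv_cancel[OF semilinearD(1)[OF g]])
  ultimately show ?thesis
    unfolding semilinear_def using field_aut_inv[OF semilinearD(1)[OF g]] bij' by blast
qed

lemma semilinear_id: "semilinear m (\<lambda>x. x) (\<lambda>x. x)"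
  by (simp add: semilinear_def field_aut_id bij_betw_def)

lemma semilinear_map_vec:
  assumes "field_aut \<tau>"
  shows "semilinear m \<tau> (map_vec \<tau>)"
  unfolding semilinear_def
proof (intro conjI ballI allI)
  show "bij_betw (map_vec \<tau>) (carrier_vec m) (carrier_vec m)"
    by (rule bij_betw_byWitness[where f' = "map_vec (inv_into UNIV \<tau>)"])
       (auto simp: vec_eq_iff field_aut_inv_cancel[OF assms])
qed (use assms in \<open>auto simp: vec_eq_iff field_aut_add field_aut_mult\<close>)

text \<open>The truncations \<open>t k\<close> assemble \<open>v\<close> one unit vector at a time.
  The result supplies transposes of linear maps without passing to matrices.\<close>

lemma linear_functional:
  fixes L :: "'k::field vec \<Rightarrow> 'k"
  assumes add: "\<And>v w. v \<in> carrier_vec m \<Longrightarrow> w \<in> carrier_vec m \<Longrightarrow> L (v + w) = L v + L w"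
    and smult: "\<And>a v. v \<in> carrier_vec m \<Longrightarrow> L (a \<cdot>\<^sub>v v) = a * L v"
    and v: "v \<in> carrier_vec m"
  shows "L v = vec m (\<lambda>j. L (unit_vec m j)) \<bullet> v"
proof -
  define t where "t k = vec m (\<lambda>j. if j < k then v $ j else 0)" for k
  have "L (t k) = (\<Sum>j<k. v $ j * L (unit_vec m j))" if "k \<le> m" for k
    using that
  proof (induction k)
    case 0
    have "t 0 = 0 \<cdot>\<^sub>v t 0" by (auto simp: t_def vec_eq_iff)
    then have "L (t 0) = 0 * L (t 0)" using smult[of "t 0" 0] by (simp add: t_def)
    then show ?case by simp
  next
    case (Suc k)
    have "t (Suc k) = t k + v $ k \<cdot>\<^sub>v unit_vec m k"
      using Suc.prems by (auto simp: t_def vec_eq_iff less_Suc_eq)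
    then have "L (t (Suc k)) = L (t k) + v $ k * L (unit_vec m k)"
      using add[of "t k" "v $ k \<cdot>\<^sub>v unit_vec m k"] smult by (simp add: t_def)
    then show ?case using Suc by simp
  qed
  moreover have "t m = v" using v by (auto simp: t_def vec_eq_iff)
  ultimately have "L v = (\<Sum>j<m. v $ j * L (unit_vec m j))" by (metis order_refl)
  also have "\<dots> = vec m (\<lambda>j. L (unit_vec m j)) \<bullet> v"
    unfolding scalar_prod_def using v by (intro sum.cong) (auto simp: mult.commute)
  finally show ?thesis .
qed

lemma scalar_prod_eqI:
  fixes v w :: "'k::field vec"
  assumes "v \<in> carrier_vec m" and "w \<in> carrier_vec m"
    and eq: "\<And>x. x \<in> carrier_vec m \<Longrightarrow> x \<bullet> v = x \<bullet> w"
  shows "v = w"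
proof (rule eq_vecI)
  fix i assume "i < dim_vec w"
  then show "v $ i = w $ i" using assms(1,2) eq[of "unit_vec m i"] by simp
qed (use assms in simp)

text \<open>The vector \<open>y\<close> is the transpose of \<open>g\<close> applied to
  \<open>x\<close>: a change of basis on the columns merely relabels the messages.\<close>

lemma code_of_linear_subset:
  assumes g: "semilinear m (\<lambda>a. a) g" and c: "columns m n c"
  shows "code_of m n (\<lambda>i. g (c i)) \<subseteq> code_of m n c"
proof
  fix w assume "w \<in> code_of m n (\<lambda>i. g (c i))"
  then obtain x where x: "x \<in> carrier_vec m" "w = word n (\<lambda>i. g (c i)) x"
    by (auto simp: code_of_def)
  define y where "y = vec m (\<lambda>j. x \<bullet> g (unit_vec m j))"
  have "x \<bullet> g v = y \<bullet> v" if "v \<in> carrier_vec m" for v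
    unfolding y_def using that x
    by (intro linear_functional[of m "\<lambda>v. x \<bullet> g v"])
       (simp_all add: semilinearD[OF g] scalar_prod_add_distrib[of _ m])
  then have "w = word n c y" using x(2) columnsD[OF c] by (simp add: word_eq_iff)
  then show "w \<in> code_of m n c" by (auto simp: code_of_def y_def)
qed

lemma code_of_linear:
  assumes g: "semilinear m (\<lambda>a. a) g" and c: "columns m n c"
  shows "code_of m n (\<lambda>i. g (c i)) = code_of m n c"
proof
  show "code_of m n (\<lambda>i. g (c i)) \<subseteq> code_of m n c"
    by (rule code_of_linear_subset[OF g c])
  let ?h = "inv_into (carrier_vec m) g"
  have "inv_into UNIV (\<lambda>a::'a. a) = (\<lambda>a. a)" by (simp add: inv_id[unfolded id_def])
  then have "semilinear m (\<lambda>a. a) ?h" using semilinear_inv[OF g] by simp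
  moreover have "columns m n (\<lambda>i. g (c i))"
    using c by (simp add: columns_def semilinearD[OF g])
  ultimately have "code_of m n (\<lambda>i. ?h (g (c i))) \<subseteq> code_of m n (\<lambda>i. g (c i))"
    by (rule code_of_linear_subset)
  moreover have "code_of m n (\<lambda>i. ?h (g (c i))) = code_of m n c"
    by (rule code_of_cong) (simp add: bij_betw_inv_into_left[OF semilinearD(2)[OF g]] columnsD[OF c])
  ultimately show "code_of m n c \<subseteq> code_of m n (\<lambda>i. g (c i))" by simp
qed

text \<open>The change of basis between two parametrisations of a code acts on the columns by its
  transpose.\<close>

lemma code_of_eq_imp_linear:
  fixes c d :: "nat \<Rightarrow> 'k::field vec"
  assumes c: "columns m n c" "spanning m n c" and d: "columns m n d" "spanning m n d"
    and eq: "code_of m n c = code_of m n d"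
  obtains g where "semilinear m (\<lambda>a. a) g" and "\<And>i. i < n \<Longrightarrow> d i = g (c i)"
proof -
  \<comment> \<open>\<open>A\<close> turns a message for \<open>d\<close> into the message for
    \<open>c\<close> with the same word; injectivity of \<open>word n c\<close> makes it linear, and
    \<open>g\<close> is its transpose. Each inclusion of codes yields one such pair, and the two
    pairs are mutually inverse.\<close>
  have step: "\<exists>A g. (\<forall>x\<in>carrier_vec m. A x \<in> carrier_vec m \<and> word n d x = word n c (A x)) \<and>
      (\<forall>v\<in>carrier_vec m. g v \<in> carrier_vec m \<and> (\<forall>x\<in>carrier_vec m. x \<bullet> g v = A x \<bullet> v))"
    if c: "columns m n c" "spanning m n c" and d: "columns m n d"
      and eq: "code_of m n d \<subseteq> code_of m n c"
    for c d :: "nat \<Rightarrow> 'k vec"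
  proof -
    have "\<forall>x\<in>carrier_vec m. \<exists>y\<in>carrier_vec m. word n d x = word n c y"
      using eq unfolding code_of_def by blast
    then obtain A where A: "\<And>x. x \<in> carrier_vec m \<Longrightarrow> A x \<in> carrier_vec m"
      "\<And>x. x \<in> carrier_vec m \<Longrightarrow> word n d x = word n c (A x)"
      by metis
    have inj: "inj_on (word n c) (carrier_vec m)" using inj_on_word_iff c by blast
    have A_add: "A (x + y) = A x + A y" if "x \<in> carrier_vec m" "y \<in> carrier_vec m" for x y
    proof (rule inj_onD[OF inj])
      show "word n c (A (x + y)) = word n c (A x + A y)"
        using that A by (simp add: word_add[OF c(1)] word_add[OF d] flip: A(2))
    qed (use A that in auto)
    have A_smult: "A (a \<cdot>\<^sub>v x) = a \<cdot>\<^sub>v A x" if "x \<in> carrier_vec m" for a x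
    proof (rule inj_onD[OF inj])
      show "word n c (A (a \<cdot>\<^sub>v x)) = word n c (a \<cdot>\<^sub>v A x)"
        using that A by (simp add: word_smult[OF c(1)] word_smult[OF d] flip: A(2))
    qed (use A that in auto)
    define g where "g v = vec m (\<lambda>j. A (unit_vec m j) \<bullet> v)" for v
    have "x \<bullet> g v = A x \<bullet> v" if "x \<in> carrier_vec m" "v \<in> carrier_vec m" for x v
    proof -
      have "A x \<bullet> v = g v \<bullet> x"
        unfolding g_def using that
        by (intro linear_functional[of m "\<lambda>x. A x \<bullet> v"])
           (simp_all add: A A_add A_smult add_scalar_prod_distrib[of _ m])
      then show ?thesis using comm_scalar_prod[OF that(1), of "g v"] by (simp add: g_def)
    qed
    moreover have "g v \<in> carrier_vec m" for v by (simp add: g_def)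
    ultimately show ?thesis using A by blast
  qed
  obtain A g where A: "\<And>x. x \<in> carrier_vec m \<Longrightarrow> A x \<in> carrier_vec m"
    "\<And>x. x \<in> carrier_vec m \<Longrightarrow> word n d x = word n c (A x)"
    and g: "\<And>v. v \<in> carrier_vec m \<Longrightarrow> g v \<in> carrier_vec m"
    "\<And>v x. v \<in> carrier_vec m \<Longrightarrow> x \<in> carrier_vec m \<Longrightarrow> x \<bullet> g v = A x \<bullet> v"
    using step[OF c d(1)] eq by blast
  obtain B h where B: "\<And>x. x \<in> carrier_vec m \<Longrightarrow> B x \<in> carrier_vec m"
    "\<And>x. x \<in> carrier_vec m \<Longrightarrow> word n c x = word n d (B x)"
    and h: "\<And>v. v \<in> carrier_vec m \<Longrightarrow> h v \<in> carrier_vec m"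
    "\<And>v x. v \<in> carrier_vec m \<Longrightarrow> x \<in> carrier_vec m \<Longrightarrow> x \<bullet> h v = B x \<bullet> v"
    using step[OF d c(1)] eq by blast
  have inj: "inj_on (word n c) (carrier_vec m)" "inj_on (word n d) (carrier_vec m)"
    using inj_on_word_iff c d by blast+
  have AB: "A (B x) = x" "B (A x) = x" if "x \<in> carrier_vec m" for x
  proof -
    show "A (B x) = x"
      by (rule inj_onD[OF inj(1) trans[OF A(2)[symmetric] B(2)[symmetric]]]) (use that A B in auto)
    show "B (A x) = x"
      by (rule inj_onD[OF inj(2) trans[OF B(2)[symmetric] A(2)[symmetric]]]) (use that A B in auto)
  qed
  \<comment> \<open>Every \<open>x\<close> pairs with \<open>d i\<close> as \<open>A x\<close> pairs
    with \<open>c i\<close>, since both values are the \<open>i\<close>-th entry of one word;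
    transposing \<open>A\<close> gives \<open>g (c i)\<close>.\<close>
  have dg: "d i = g (c i)" if "i < n" for i
  proof (rule scalar_prod_eqI[of _ m])
    show "x \<bullet> d i = x \<bullet> g (c i)" if "x \<in> carrier_vec m" for x
      using A(2)[OF that] \<open>i < n\<close> that g(2) columnsD[OF c(1)] by (simp add: word_eq_iff)
  qed (use that columnsD[OF c(1)] columnsD[OF d(1)] g in auto)
  have "semilinear m (\<lambda>a. a) g"
    unfolding semilinear_def
  proof (intro conjI ballI allI)
    have "h (g v) = v" if "v \<in> carrier_vec m" for v
      by (rule scalar_prod_eqI[of _ m]) (use that g h A B AB in auto)
    moreover have "g (h v) = v" if "v \<in> carrier_vec m" for v
      by (rule scalar_prod_eqI[of _ m]) (use that g h A B AB in auto)
    ultimately show "bij_betw g (carrier_vec m) (carrier_vec m)"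
      using g h by (intro bij_betw_byWitness[where f' = h]) auto
    show "g (x + y) = g x + g y" if "x \<in> carrier_vec m" "y \<in> carrier_vec m" for x y
      by (rule scalar_prod_eqI[of _ m])
         (use that g A in \<open>auto simp: scalar_prod_add_distrib[of _ m]\<close>)
    show "g (a \<cdot>\<^sub>v x) = a \<cdot>\<^sub>v g x" if "x \<in> carrier_vec m" for a x
      by (rule scalar_prod_eqI[of _ m]) (use that g A in auto)
  qed (rule field_aut_id)
  then show ?thesis using dg by (rule that)
qed

section \<open>The code group in normal form\<close>

text \<open>Permutation first, then field automorphism, then scaling. The restriction yields
  \<open>undefined\<close> outside \<open>carrier_vec n\<close>, as membership in
  \<open>BijGroup\<close> demands.\<close>

definition monomial_map ::
    "nat \<Rightarrow> (nat \<Rightarrow> nat) \<Rightarrow> (nat \<Rightarrow> 'k::field) \<Rightarrow> ('k \<Rightarrow> 'k) \<Rightarrow> 'k vec \<Rightarrow> 'k vec" where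
  "monomial_map n \<pi> a \<tau> = (\<lambda>v\<in>carrier_vec n. vec n (\<lambda>i. a i * \<tau> (v $ \<pi> i)))"

definition monomial_data :: "nat \<Rightarrow> (nat \<Rightarrow> nat) \<Rightarrow> (nat \<Rightarrow> 'k::field) \<Rightarrow> ('k \<Rightarrow> 'k) \<Rightarrow> bool" where
  "monomial_data n \<pi> a \<tau> \<longleftrightarrow> \<pi> permutes {..<n} \<and> (\<forall>i<n. a i \<noteq> 0) \<and> field_aut \<tau>"

text \<open>The semidirect product rule: the inner scalars are permuted and twisted by the outer
  automorphism, and the permutations compose in reverse order because they act on indices.\<close>

lemma monomial_map_comp:
  assumes "monomial_data n \<pi> a \<tau>" and "monomial_data n \<pi>' a' \<tau>'"
  shows "compose (carrier_vec n) (monomial_map n \<pi>' a' \<tau>') (monomial_map n \<pi> a \<tau>)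
      = monomial_map n (\<pi> \<circ> \<pi>') (\<lambda>i. a' i * \<tau>' (a (\<pi>' i))) (\<tau>' \<circ> \<tau>)"
    and "monomial_data n (\<pi> \<circ> \<pi>') (\<lambda>i. a' i * \<tau>' (a (\<pi>' i))) (\<tau>' \<circ> \<tau>)"
proof -
  have \<pi>': "\<pi>' i < n" if "i < n" for i
    using permutes_in_image[of \<pi>' "{..<n}" i] assms(2) that by (simp add: monomial_data_def)
  show "compose (carrier_vec n) (monomial_map n \<pi>' a' \<tau>') (monomial_map n \<pi> a \<tau>)
      = monomial_map n (\<pi> \<circ> \<pi>') (\<lambda>i. a' i * \<tau>' (a (\<pi>' i))) (\<tau>' \<circ> \<tau>)"
    using assms
    by (auto simp: compose_def monomial_map_def fun_eq_iff vec_eq_iff \<pi>' monomial_data_def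
        field_aut_mult mult.assoc)
  show "monomial_data n (\<pi> \<circ> \<pi>') (\<lambda>i. a' i * \<tau>' (a (\<pi>' i))) (\<tau>' \<circ> \<tau>)"
    using assms \<pi>'
    by (auto simp: monomial_data_def permutes_compose field_aut_comp field_aut_eq_0_iff)
qed

lemma monomial_map_id: "monomial_map n (\<lambda>i. i) (\<lambda>i. 1) (\<lambda>x. x) = (\<lambda>v\<in>carrier_vec n. v)"
  by (auto simp: monomial_map_def fun_eq_iff vec_eq_iff)

lemma monomial_data_id: "monomial_data n (\<lambda>i. i) (\<lambda>i. 1) (\<lambda>x. x)"
  by (simp add: monomial_data_def field_aut_id permutes_id[unfolded id_def])

lemma monomial_map_cong:
  assumes "\<And>i. i < n \<Longrightarrow> \<pi> i = \<pi>' i" and "\<And>i. i < n \<Longrightarrow> a i = a' i" and "\<And>x. \<tau> x = \<tau>' x"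
  shows "monomial_map n \<pi> a \<tau> = monomial_map n \<pi>' a' \<tau>'"
  using assms by (auto simp: monomial_map_def fun_eq_iff vec_eq_iff)

lemma monomial_map_inverse:
  assumes "monomial_data n \<pi> a \<tau>"
  obtains \<pi>' a' \<tau>' where "monomial_data n \<pi>' a' \<tau>'"
    and "compose (carrier_vec n) (monomial_map n \<pi>' a' \<tau>') (monomial_map n \<pi> a \<tau>)
       = (\<lambda>v\<in>carrier_vec n. v)"
    and "compose (carrier_vec n) (monomial_map n \<pi> a \<tau>) (monomial_map n \<pi>' a' \<tau>')
       = (\<lambda>v\<in>carrier_vec n. v)"
proof -
  let ?\<pi> = "inv_into UNIV \<pi>" and ?\<tau> = "inv_into UNIV \<tau>"
  have \<pi>: "\<pi> permutes {..<n}" and \<tau>: "field_aut \<tau>" and a: "\<And>i. i < n \<Longrightarrow> a i \<noteq> 0"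
    using assms by (auto simp: monomial_data_def)
  have \<pi>n: "?\<pi> i < n" "\<pi> i < n" if "i < n" for i
    using permutes_in_image[OF permutes_inv[OF \<pi>], of i] permutes_in_image[OF \<pi>, of i] that
    by simp_all
  \<comment> \<open>The solution of \<open>a i * \<tau> (b (\<pi> i)) = 1\<close>, which makes the
    scalars of the composite trivial.\<close>
  define b where "b i = 1 / ?\<tau> (a (?\<pi> i))" for i
  note \<tau>' = field_aut_inv[OF \<tau>]
  have data: "monomial_data n ?\<pi> b ?\<tau>"
    unfolding monomial_data_def
    using permutes_inv[OF \<pi>] \<tau>' a \<pi>n by (auto simp: b_def field_aut_eq_0_iff)
  have inv_a: "a i * \<tau> (b (\<pi> i)) = 1" if "i < n" for i
  proof -
    have "?\<tau> (a i) * b (\<pi> i) = 1"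
      using a[OF that] \<tau>' by (simp add: b_def permutes_inverses[OF \<pi>] field_aut_eq_0_iff)
    then have "\<tau> (?\<tau> (a i) * b (\<pi> i)) = 1" using field_aut_1[OF \<tau>] by simp
    then show ?thesis by (simp add: field_aut_mult[OF \<tau>] field_aut_inv_cancel[OF \<tau>])
  qed
  show ?thesis
  proof (rule that[OF data])
    show "compose (carrier_vec n) (monomial_map n ?\<pi> b ?\<tau>) (monomial_map n \<pi> a \<tau>)
       = (\<lambda>v\<in>carrier_vec n. v)"
      unfolding monomial_map_comp(1)[OF assms data] monomial_map_id[symmetric]
      using a \<pi>n \<tau>'
      by (intro monomial_map_cong)
         (auto simp: permutes_inverses[OF \<pi>] field_aut_inv_cancel[OF \<tau>] b_def field_aut_eq_0_iff)
    show "compose (carrier_vec n) (monomial_map n \<pi> a \<tau>) (monomial_map n ?\<pi> b ?\<tau>)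
       = (\<lambda>v\<in>carrier_vec n. v)"
      unfolding monomial_map_comp(1)[OF data assms] monomial_map_id[symmetric]
      by (intro monomial_map_cong)
         (auto simp: permutes_inverses[OF \<pi>] field_aut_inv_cancel[OF \<tau>] inv_a)
  qed
qed

lemma monomial_map_Bij:
  assumes "monomial_data n \<pi> a \<tau>"
  shows "monomial_map n \<pi> a \<tau> \<in> Bij (carrier_vec n)"
proof -
  obtain \<pi>' a' \<tau>' where inv: "monomial_data n \<pi>' a' \<tau>'"
    "compose (carrier_vec n) (monomial_map n \<pi>' a' \<tau>') (monomial_map n \<pi> a \<tau>) = (\<lambda>v\<in>carrier_vec n. v)"
    "compose (carrier_vec n) (monomial_map n \<pi> a \<tau>) (monomial_map n \<pi>' a' \<tau>') = (\<lambda>v\<in>carrier_vec n. v)"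
    by (rule monomial_map_inverse[OF assms])
  have into: "monomial_map n p b t v \<in> carrier_vec n" if "v \<in> carrier_vec n" for p b t and v :: "'a vec"
    using that by (simp add: monomial_map_def)
  have "bij_betw (monomial_map n \<pi> a \<tau>) (carrier_vec n) (carrier_vec n)"
  proof (rule bij_betw_byWitness[where f' = "monomial_map n \<pi>' a' \<tau>'"])
    show "\<forall>v\<in>carrier_vec n. monomial_map n \<pi>' a' \<tau>' (monomial_map n \<pi> a \<tau> v) = v"
      using fun_cong[OF inv(2)] by (metis compose_eq restrict_apply')
    show "\<forall>v\<in>carrier_vec n. monomial_map n \<pi> a \<tau> (monomial_map n \<pi>' a' \<tau>' v) = v"
      using fun_cong[OF inv(3)] by (metis compose_eq restrict_apply')
  qed (use into in auto)
  then show ?thesis by (simp add: Bij_def monomial_map_def)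
qed

lemma monomial_map_mult:
  assumes "monomial_data n \<pi> a \<tau>" and "monomial_data n \<pi>' a' \<tau>'"
  shows "monomial_map n \<pi>' a' \<tau>' \<otimes>\<^bsub>BijGroup (carrier_vec n)\<^esub> monomial_map n \<pi> a \<tau>
      = compose (carrier_vec n) (monomial_map n \<pi>' a' \<tau>') (monomial_map n \<pi> a \<tau>)"
  using assms[THEN monomial_map_Bij] by (simp add: BijGroup_def)

lemma coord_perms_eq:
  "coord_perms n = {monomial_map n \<pi> (\<lambda>i. 1) (\<lambda>x. x) | \<pi>. \<pi> permutes {..<n}}"
  by (simp add: coord_perms_def monomial_map_def)

lemma coord_scalings_eq:
  "coord_scalings n = {monomial_map n (\<lambda>i. i) a (\<lambda>x. x) | a. \<forall>i<n. a i \<noteq> 0}"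
  by (simp add: coord_scalings_def monomial_map_def)

lemma field_auts_eq:
  "field_auts n = {monomial_map n (\<lambda>i. i) (\<lambda>i. 1) \<tau> | \<tau>. field_aut \<tau>}"
proof -
  have "(\<lambda>v\<in>carrier_vec n. map_vec \<tau> v) = monomial_map n (\<lambda>i. i) (\<lambda>i. 1) \<tau>"
    for \<tau> :: "'a \<Rightarrow> 'a"
    by (auto simp: monomial_map_def fun_eq_iff vec_eq_iff)
  then show ?thesis by (simp add: field_auts_def)
qed

text \<open>Normal forms include the generators and are closed under product and inverse; conversely
  each factors into a scaling, a permutation and a field automorphism. An isomorphism of codes is
  therefore one explicit map.\<close>

lemma code_group_eq:
  "code_group n = {monomial_map n \<pi> a \<tau> | \<pi> a \<tau> :: 'k::field \<Rightarrow> 'k. monomial_data n \<pi> a \<tau>}"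
proof
  let ?G = "BijGroup (carrier_vec n :: 'k vec set)"
  interpret group ?G by (rule group_BijGroup)
  let ?M = "{monomial_map n \<pi> a \<tau> | \<pi> a \<tau> :: 'k \<Rightarrow> 'k. monomial_data n \<pi> a \<tau>}"
  let ?gens = "coord_perms n \<union> coord_scalings n \<union> field_auts n :: ('k vec \<Rightarrow> 'k vec) set"
  have gens: "?gens \<subseteq> ?M"
  proof -
    have "coord_perms n \<subseteq> ?M" unfolding coord_perms_eq
      by (fastforce simp: monomial_data_def field_aut_id)
    moreover have "coord_scalings n \<subseteq> ?M" unfolding coord_scalings_eq
      using permutes_id[of "{..<n}", unfolded id_def]
      by (fastforce simp: monomial_data_def field_aut_id)
    moreover have "field_auts n \<subseteq> ?M" unfolding field_auts_eq
      using permutes_id[of "{..<n}", unfolded id_def]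
      by (fastforce simp: monomial_data_def)
    ultimately show ?thesis by blast
  qed
  show "code_group n \<subseteq> ?M"
  proof
    fix g :: "'k vec \<Rightarrow> 'k vec" assume "g \<in> code_group n"
    then have "g \<in> generate ?G ?gens" by (simp add: code_group_def)
    then show "g \<in> ?M"
    proof induction
      case one
      have "\<one>\<^bsub>?G\<^esub> = monomial_map n (\<lambda>i. i) (\<lambda>i. 1) (\<lambda>x. x)"
        by (simp add: BijGroup_def monomial_map_id)
      then show ?case using monomial_data_id by blast
    next
      case (incl h)
      then show ?case using gens by blast
    next
      case (inv h)
      then obtain \<pi> a \<tau> where h: "h = monomial_map n \<pi> a \<tau>" "monomial_data n \<pi> a \<tau>"
        using gens by blast
      obtain \<pi>' a' \<tau>' where h': "monomial_data n \<pi>' a' \<tau>'"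
        "compose (carrier_vec n) (monomial_map n \<pi>' a' \<tau>') h = (\<lambda>v\<in>carrier_vec n. v)"
        unfolding h(1) by (rule monomial_map_inverse[OF h(2)])
      have "inv\<^bsub>?G\<^esub> h = monomial_map n \<pi>' a' \<tau>'"
      proof (rule inv_equality)
        show "monomial_map n \<pi>' a' \<tau>' \<otimes>\<^bsub>?G\<^esub> h = \<one>\<^bsub>?G\<^esub>"
          using h' monomial_map_mult[OF h(2) h'(1)] by (simp add: h(1)) (simp add: BijGroup_def)
        show "h \<in> carrier ?G" "monomial_map n \<pi>' a' \<tau>' \<in> carrier ?G"
          using monomial_map_Bij h h'(1) by (simp_all add: BijGroup_def)
      qed
      then show ?case using h'(1) by blast
    next
      case (eng h1 h2)
      then show ?case
        using monomial_map_mult monomial_map_comp by (smt (verit) mem_Collect_eq)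
    qed
  qed
  show "?M \<subseteq> code_group n"
  proof
    fix g :: "'k vec \<Rightarrow> 'k vec" assume "g \<in> ?M"
    then obtain \<pi> a and \<tau> :: "'k \<Rightarrow> 'k" where g: "g = monomial_map n \<pi> a \<tau>" "monomial_data n \<pi> a \<tau>"
      by blast
    have d\<tau>: "monomial_data n (\<lambda>i. i) (\<lambda>i. 1) \<tau>" and d\<pi>: "monomial_data n \<pi> (\<lambda>i. 1) (\<lambda>x::'k. x)"
      and da: "monomial_data n (\<lambda>i. i) a (\<lambda>x. x)"
      using g(2) permutes_id[of "{..<n}", unfolded id_def] by (auto simp: monomial_data_def field_aut_id)
    have "monomial_map n \<pi> (\<lambda>i. 1) (\<lambda>x. x) \<otimes>\<^bsub>?G\<^esub> monomial_map n (\<lambda>i. i) (\<lambda>i. 1) \<tau>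
        = monomial_map n \<pi> (\<lambda>i. 1) \<tau>"
      unfolding monomial_map_mult[OF d\<tau> d\<pi>] monomial_map_comp(1)[OF d\<tau> d\<pi>] by (simp add: o_def)
    moreover have d: "monomial_data n \<pi> (\<lambda>i. 1) \<tau>" using g(2) by (simp add: monomial_data_def)
    moreover have "monomial_map n (\<lambda>i. i) a (\<lambda>x. x) \<otimes>\<^bsub>?G\<^esub> monomial_map n \<pi> (\<lambda>i. 1) \<tau> = g"
      unfolding monomial_map_mult[OF d da] monomial_map_comp(1)[OF d da] g(1) by (simp add: o_def)
    moreover have "monomial_map n \<pi> (\<lambda>i. 1) (\<lambda>x. x) \<in> ?gens"
      using g(2) unfolding coord_perms_eq monomial_data_def by blast
    moreover have "monomial_map n (\<lambda>i. i) a (\<lambda>x. x) \<in> ?gens"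
      using g(2) unfolding coord_scalings_eq monomial_data_def by blast
    moreover have "monomial_map n (\<lambda>i. i) (\<lambda>i. 1) \<tau> \<in> ?gens"
      using g(2) unfolding field_auts_eq monomial_data_def by blast
    ultimately show "g \<in> code_group n"
      unfolding code_group_def by (metis generate.incl generate.eng)
  qed
qed

text \<open>A field automorphism commutes with the pairing when applied to message and column alike,
  and it permutes the messages, so its effect can be moved entirely to the columns.\<close>

lemma monomial_map_image_code_of:
  assumes mon: "monomial_data n \<pi> a \<tau>" and c: "columns m n c"
  shows "monomial_map n \<pi> a \<tau> ` code_of m n c = code_of m n (\<lambda>i. a i \<cdot>\<^sub>v map_vec \<tau> (c (\<pi> i)))"
    (is "_ = code_of m n ?c'")
proof -
  have \<pi>: "\<pi> i < n" if "i < n" for i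
    using permutes_in_image[of \<pi> "{..<n}" i] mon that by (simp add: monomial_data_def)
  have \<tau>: "field_aut \<tau>" using mon by (simp add: monomial_data_def)
  have "monomial_map n \<pi> a \<tau> (word n c x) = word n ?c' (map_vec \<tau> x)" if "x \<in> carrier_vec m" for x
  proof (rule eq_vecI)
    fix i assume "i < dim_vec (word n ?c' (map_vec \<tau> x))"
    then have i: "i < n" by (simp add: word_def)
    have ci: "c (\<pi> i) \<in> carrier_vec m" using columnsD[OF c \<pi>[OF i]] .
    have "monomial_map n \<pi> a \<tau> (word n c x) $ i = a i * \<tau> (x \<bullet> c (\<pi> i))"
      using i \<pi> by (simp add: monomial_map_def)
    then show "monomial_map n \<pi> a \<tau> (word n c x) $ i = word n ?c' (map_vec \<tau> x) $ i"
      using i field_aut_scalar_prod[OF \<tau> that ci] that ci by simp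
  qed (simp add: monomial_map_def word_def)
  then have "monomial_map n \<pi> a \<tau> ` code_of m n c = word n ?c' ` map_vec \<tau> ` carrier_vec m"
    unfolding code_of_def image_image by (intro image_cong) auto
  also have "map_vec \<tau> ` carrier_vec m = carrier_vec m"
    using semilinearD(2)[OF semilinear_map_vec[OF \<tau>]] by (simp add: bij_betw_def)
  finally show ?thesis by (simp add: code_of_def)
qed

text \<open>Write \<open>g\<close> as a linear \<open>h\<close> after \<open>map_vec \<tau>\<close>.
  The linear factor does not change the code, and everything else is a monomial map. Spanning
  transfers by comparing cardinalities.\<close>

lemma code_iso_twist:
  fixes c d :: "nat \<Rightarrow> 'k::{field,finite} vec"
  assumes c: "columns m n c" "spanning m n c" and d: "columns m n d"
    and g: "semilinear m \<tau> g" and \<pi>: "\<pi> permutes {..<n}" and a: "\<forall>i<n. a i \<noteq> 0"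
    and d_eq: "\<And>i. i < n \<Longrightarrow> d i = a i \<cdot>\<^sub>v g (c (\<pi> i))"
  shows "code_iso n (code_of m n c) (code_of m n d)" and "spanning m n d"
proof -
  let ?\<tau> = "inv_into UNIV \<tau>"
  have \<tau>: "field_aut \<tau>" by (rule semilinearD(1)[OF g])
  have \<pi>n: "\<pi> i < n" if "i < n" for i
    using permutes_in_image[OF \<pi>, of i] that by simp
  have mon: "monomial_data n \<pi> a \<tau>" using \<pi> a \<tau> by (simp add: monomial_data_def)
  define c' where "c' i = a i \<cdot>\<^sub>v map_vec \<tau> (c (\<pi> i))" for i
  have c': "columns m n c'" using c(1) \<pi>n by (simp add: columns_def c'_def)
  define h where "h = g \<circ> map_vec ?\<tau>"
  have "\<tau> \<circ> ?\<tau> = (\<lambda>x. x)" using field_aut_inv_cancel(2)[OF \<tau>] by (simp add: fun_eq_iff)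
  then have h: "semilinear m (\<lambda>x. x) h"
    unfolding h_def using semilinear_comp[OF g semilinear_map_vec[OF field_aut_inv[OF \<tau>]]] by simp
  have "d i = h (c' i)" if "i < n" for i
  proof -
    have "map_vec ?\<tau> (map_vec \<tau> (c (\<pi> i))) = c (\<pi> i)"
      by (auto simp: vec_eq_iff field_aut_inv_cancel[OF \<tau>])
    then have "h (map_vec \<tau> (c (\<pi> i))) = g (c (\<pi> i))" by (simp add: h_def)
    then show ?thesis
      using semilinearD(5)[OF h, of "map_vec \<tau> (c (\<pi> i))" "a i"] columnsD[OF c(1) \<pi>n[OF that]]
      by (simp add: c'_def d_eq[OF that])
  qed
  then have "code_of m n d = code_of m n (\<lambda>i. h (c' i))" by (rule code_of_cong)
  then have eq: "code_of m n d = monomial_map n \<pi> a \<tau> ` code_of m n c"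
    unfolding code_of_linear[OF h c'] by (simp add: monomial_map_image_code_of[OF mon c(1)] c'_def[abs_def])
  then show "code_iso n (code_of m n c) (code_of m n d)"
    unfolding code_iso_def code_group_eq using mon by blast
  have "inj_on (monomial_map n \<pi> a \<tau>) (code_of m n c)"
    using monomial_map_Bij[OF mon]
    by (auto simp: Bij_def bij_betw_def code_of_def intro: inj_on_subset)
  then have "card (code_of m n d) = card (code_of m n c)" by (simp add: eq card_image)
  then show "spanning m n d" using spanning_iff_card c d by metis
qed

text \<open>Converse to \<open>code_iso_twist\<close>: the monomially transformed matrix and
  \<open>d\<close> have the same code, so they differ by a linear bijection, which absorbs the field
  automorphism into a semilinear map.\<close>

lemma code_isoE:
  fixes c d :: "nat \<Rightarrow> 'k::{field,finite} vec"
  assumes c: "columns m n c" "spanning m n c" and d: "columns m n d" "spanning m n d"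
    and iso: "code_iso n (code_of m n c) (code_of m n d)"
  obtains \<tau> g \<pi> a where "semilinear m \<tau> g" and "\<pi> permutes {..<n}" and "\<forall>i<n. a i \<noteq> 0"
    and "\<And>i. i < n \<Longrightarrow> d i = a i \<cdot>\<^sub>v g (c (\<pi> i))"
proof -
  obtain \<pi> a and \<tau> :: "'k \<Rightarrow> 'k" where mon: "monomial_data n \<pi> a \<tau>"
    and eq: "code_of m n d = monomial_map n \<pi> a \<tau> ` code_of m n c"
    using iso unfolding code_iso_def code_group_eq by blast
  have \<pi>: "\<pi> permutes {..<n}" and a: "\<forall>i<n. a i \<noteq> 0" and \<tau>: "field_aut \<tau>"
    using mon by (simp_all add: monomial_data_def)
  have \<pi>n: "\<pi> i < n" if "i < n" for i
    using permutes_in_image[OF \<pi>, of i] that by simp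
  define c' where "c' i = a i \<cdot>\<^sub>v map_vec \<tau> (c (\<pi> i))" for i
  have c': "columns m n c'" using c(1) \<pi>n by (simp add: columns_def c'_def)
  have eq': "code_of m n c' = code_of m n d"
    unfolding eq monomial_map_image_code_of[OF mon c(1)] c'_def[abs_def] ..
  then have "spanning m n c'" using spanning_iff_card c' d by metis
  then obtain h where h: "semilinear m (\<lambda>x. x) h" "\<And>i. i < n \<Longrightarrow> d i = h (c' i)"
    using code_of_eq_imp_linear[OF c' _ d eq'] by blast
  have "semilinear m \<tau> (h \<circ> map_vec \<tau>)"
    using semilinear_comp[OF h(1) semilinear_map_vec[OF \<tau>]] by (simp add: o_def)
  moreover have "d i = a i \<cdot>\<^sub>v (h \<circ> map_vec \<tau>) (c (\<pi> i))" if "i < n" for i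
    using h(2)[OF that] semilinearD(5)[OF h(1), of "map_vec \<tau> (c (\<pi> i))" "a i"]
      columnsD[OF c(1) \<pi>n[OF that]]
    by (simp add: c'_def)
  ultimately show ?thesis using that \<pi> a by blast
qed

section \<open>Multiplicities of lines\<close>

text \<open>Only nonzero multiples are taken, so these are orbits of the scalars: punctured lines,
  that is, projective points, and the separate class of \<open>0\<close> for zero columns.\<close>

definition line :: "'k::field vec \<Rightarrow> 'k vec set" where
  "line v = {a \<cdot>\<^sub>v v | a. a \<noteq> 0}"

definition lines :: "nat \<Rightarrow> 'k::field vec set set" where
  "lines m = line ` carrier_vec m"

lemma line_eq_iff: "line v = line w \<longleftrightarrow> (\<exists>a. a \<noteq> 0 \<and> v = a \<cdot>\<^sub>v w)"
proof
  assume eq: "line v = line w"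
  have "v \<in> line v" unfolding line_def by (intro CollectI exI[of _ 1]) simp
  then show "\<exists>a. a \<noteq> 0 \<and> v = a \<cdot>\<^sub>v w" unfolding eq by (auto simp: line_def)
next
  assume "\<exists>a. a \<noteq> 0 \<and> v = a \<cdot>\<^sub>v w"
  then obtain a where a: "a \<noteq> 0" "v = a \<cdot>\<^sub>v w" by blast
  have "b \<cdot>\<^sub>v v = (b * a) \<cdot>\<^sub>v w" "b \<cdot>\<^sub>v w = (b / a) \<cdot>\<^sub>v v" for b
    using a by (simp_all add: smult_smult_assoc)
  moreover have "b * a \<noteq> 0" "b / a \<noteq> 0" if "b \<noteq> 0" for b using a that by simp_all
  ultimately show "line v = line w" unfolding line_def by blast
qed

lemma finite_lines: "finite (lines m :: 'k::{field,finite} vec set set)"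
  unfolding lines_def by (simp add: finite_carrier_vec)

lemma semilinear_line_iff:
  assumes g: "semilinear m \<tau> g" and v: "v \<in> carrier_vec m" and w: "w \<in> carrier_vec m"
  shows "line (g v) = line (g w) \<longleftrightarrow> line v = line w"
proof -
  have \<tau>: "field_aut \<tau>" by (rule semilinearD(1)[OF g])
  have inj: "g v = g (a \<cdot>\<^sub>v w) \<longleftrightarrow> v = a \<cdot>\<^sub>v w" for a
    using semilinearD(2)[OF g] v w by (auto simp: bij_betw_def inj_on_eq_iff)
  have "line (g v) = line (g w) \<longleftrightarrow> (\<exists>a. a \<noteq> 0 \<and> g v = \<tau> a \<cdot>\<^sub>v g w)"
    unfolding line_eq_iff by (metis field_aut_inv_cancel(2)[OF \<tau>] field_aut_eq_0_iff[OF \<tau>])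
  then show ?thesis using inj w by (simp add: semilinearD(5)[OF g, symmetric] line_eq_iff)
qed

text \<open>The projective semilinear group, acting on the projective points and the class of
  \<open>0\<close>. Its elements are permutations of the whole type that fix everything outside
  \<open>lines m\<close>, so plain composition and inverse suffice.\<close>

definition collineations :: "nat \<Rightarrow> ('k::field vec set \<Rightarrow> 'k vec set) set" where
  "collineations m = {\<sigma>. \<sigma> permutes lines m \<and>
     (\<exists>\<tau> g. semilinear m \<tau> g \<and> (\<forall>v\<in>carrier_vec m. \<sigma> (line v) = line (g v)))}"

lemma collineationsE:
  assumes "\<sigma> \<in> collineations m"
  obtains \<tau> g where "\<sigma> permutes lines m" and "semilinear m \<tau> g"
    and "\<And>v. v \<in> carrier_vec m \<Longrightarrow> \<sigma> (line v) = line (g v)"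
  using assms unfolding collineations_def by blast

text \<open>The action is defined through chosen representatives; \<open>semilinear_line_iff\<close>
  makes it independent of the choice and injective.\<close>

lemma collineation_of_semilinear:
  assumes g: "semilinear m \<tau> g"
  obtains \<sigma> where "\<sigma> \<in> collineations m"
    and "\<And>v. v \<in> carrier_vec m \<Longrightarrow> \<sigma> (line v) = line (g v)"
proof -
  define r :: "'a vec set \<Rightarrow> 'a vec"
    where "r P = (SOME v. v \<in> carrier_vec m \<and> line v = P)" for P
  have r: "r P \<in> carrier_vec m" "line (r P) = P" if "P \<in> lines m" for P
  proof -
    have "\<exists>v. v \<in> carrier_vec m \<and> line v = P" using that by (auto simp: lines_def)
    then have "r P \<in> carrier_vec m \<and> line (r P) = P" unfolding r_def by (rule someI_ex)
    then show "r P \<in> carrier_vec m" "line (r P) = P" by auto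
  qed
  define \<sigma> where "\<sigma> P = (if P \<in> lines m then line (g (r P)) else P)" for P
  have \<sigma>: "\<sigma> (line v) = line (g v)" if "v \<in> carrier_vec m" for v
  proof -
    have P: "line v \<in> lines m" using that by (simp add: lines_def)
    then have "line (g (r (line v))) = line (g v)"
      using r[OF P] semilinear_line_iff[OF g _ that] by blast
    then show ?thesis using P by (simp add: \<sigma>_def)
  qed
  have "\<sigma> permutes lines m"
  proof (rule bij_imp_permutes)
    have "inj_on \<sigma> (lines m)"
      unfolding lines_def by (rule inj_onI) (auto simp: \<sigma> semilinear_line_iff[OF g])
    moreover have "\<sigma> ` lines m = lines m"
    proof -
      have "\<sigma> ` lines m = line ` g ` carrier_vec m"
        unfolding lines_def image_image using \<sigma> by (intro image_cong) auto
      then show ?thesis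
        using semilinearD(2)[OF g] by (simp add: lines_def bij_betw_def)
    qed
    ultimately show "bij_betw \<sigma> (lines m) (lines m)" by (simp add: bij_betw_def)
  qed (simp add: \<sigma>_def)
  then have "\<sigma> \<in> collineations m" using g \<sigma> unfolding collineations_def by blast
  then show ?thesis using \<sigma> by (rule that)
qed

lemma collineations_id: "id \<in> collineations m"
  unfolding collineations_def using semilinear_id[of m] by (auto intro!: permutes_id)

lemma collineations_comp:
  assumes "\<sigma> \<in> collineations m" and "\<rho> \<in> collineations m"
  shows "\<sigma> \<circ> \<rho> \<in> collineations m"
proof -
  obtain \<tau> g where g: "\<sigma> permutes lines m" "semilinear m \<tau> g"
    "\<And>v. v \<in> carrier_vec m \<Longrightarrow> \<sigma> (line v) = line (g v)"
    using assms(1) by (rule collineationsE) blast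
  obtain \<tau>' g' where g': "\<rho> permutes lines m" "semilinear m \<tau>' g'"
    "\<And>v. v \<in> carrier_vec m \<Longrightarrow> \<rho> (line v) = line (g' v)"
    using assms(2) by (rule collineationsE) blast
  have "(\<sigma> \<circ> \<rho>) (line v) = line ((g \<circ> g') v)" if "v \<in> carrier_vec m" for v
    using that g(3) g'(3) semilinearD(3)[OF g'(2)] by simp
  then show ?thesis
    unfolding collineations_def
    using permutes_compose[OF g'(1) g(1)] semilinear_comp[OF g(2) g'(2)] by blast
qed

lemma collineations_inv:
  assumes "\<sigma> \<in> collineations m"
  shows "inv_into UNIV \<sigma> \<in> collineations m"
proof -
  obtain \<tau> g where g: "\<sigma> permutes lines m" "semilinear m \<tau> g"
    "\<And>v. v \<in> carrier_vec m \<Longrightarrow> \<sigma> (line v) = line (g v)"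
    using assms by (rule collineationsE) blast
  let ?h = "inv_into (carrier_vec m) g"
  have h: "semilinear m (inv_into UNIV \<tau>) ?h" by (rule semilinear_inv[OF g(2)])
  have "inv_into UNIV \<sigma> (line v) = line (?h v)" if "v \<in> carrier_vec m" for v
  proof -
    have "\<sigma> (line (?h v)) = line v"
      using g(3)[OF semilinearD(3)[OF h that]] bij_betw_inv_into_right[OF semilinearD(2)[OF g(2)] that]
      by simp
    then show ?thesis using permutes_inv_eq[OF g(1)] by blast
  qed
  then show ?thesis unfolding collineations_def using permutes_inv[OF g(1)] h by blast
qed

section \<open>Generator matrices as multisets of lines\<close>

definition line_mult :: "nat \<Rightarrow> (nat \<Rightarrow> 'k::field vec) \<Rightarrow> 'k vec set \<Rightarrow> nat" where
  "line_mult n c P = card {i. i < n \<and> line (c i) = P}"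

lemma line_mult_supported: "columns m n c \<Longrightarrow> line_mult n c \<in> supported_on (lines m)"
  by (auto simp: line_mult_def supported_on_def lines_def columns_def)

lemma sum_line_mult:
  fixes c :: "nat \<Rightarrow> 'k::{field,finite} vec"
  assumes "columns m n c"
  shows "sum (line_mult n c) (lines m) = n"
proof -
  have "sum (line_mult n c) (lines m) = card (\<Union>P\<in>lines m. {i. i < n \<and> line (c i) = P})"
    unfolding line_mult_def by (rule card_UN_disjoint[symmetric]) (auto simp: finite_lines)
  also have "(\<Union>P\<in>lines m. {i. i < n \<and> line (c i) = P}) = {..<n}"
    using assms by (auto simp: lines_def columns_def)
  finally show ?thesis by simp
qed

text \<open>Induction on the total: one unit of multiplicity is removed, and a representative of its
  line is appended as the last column.\<close>

lemma line_mult_realise: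
  fixes f :: "'k::{field,finite} vec set \<Rightarrow> nat"
  assumes "f \<in> supported_on (lines m)"
  shows "\<exists>c. columns m (sum f (lines m)) c \<and> line_mult (sum f (lines m)) c = f"
  using assms
proof (induction "sum f (lines m)" arbitrary: f)
  case 0
  then have "f P = 0" for P
    by (cases "P \<in> lines m") (simp_all add: supported_on_def finite_lines)
  then have "line_mult 0 undefined = f" by (auto simp: line_mult_def fun_eq_iff)
  then show ?case unfolding 0(1)[symmetric] by (auto simp: columns_def)
next
  case (Suc n)
  have "\<exists>P\<in>lines m. f P > 0" using Suc(2) by (metis Zero_not_Suc gr0I sum.neutral)
  then obtain v where v: "v \<in> carrier_vec m" "f (line v) > 0" by (auto simp: lines_def)
  then have vl: "line v \<in> lines m" by (simp add: lines_def)
  define h where "h = f(line v := f (line v) - 1)"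
  have h: "h \<in> supported_on (lines m)"
    using Suc.prems by (simp add: h_def supported_on_def)
  have "sum f (lines m) = Suc (sum h (lines m))"
    using v(2) by (simp add: h_def sum.remove[OF finite_lines vl])
  then have n: "n = sum h (lines m)" using Suc(2) by simp
  obtain c where c: "columns m n c" "line_mult n c = h" using Suc(1)[OF n h] n by auto
  define d where "d = c(n := v)"
  have "columns m (Suc n) d" using c(1) v(1) by (simp add: d_def columns_def less_Suc_eq)
  moreover have "line_mult (Suc n) d = f"
  proof
    fix P
    have "{i. i < Suc n \<and> line (d i) = P}
        = {i. i < n \<and> line (c i) = P} \<union> (if line v = P then {n} else {})"
      by (auto simp: d_def less_Suc_eq)
    then have "line_mult (Suc n) d P = line_mult n c P + (if line v = P then 1 else 0)"
      unfolding line_mult_def by simp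
    then show "line_mult (Suc n) d P = f P" using c(2) v(2) by (auto simp: h_def)
  qed
  ultimately show ?case unfolding Suc(2)[symmetric] by blast
qed

text \<open>Counting columns by their lines forgets precisely the permutation and the scalars, and
  the semilinear map survives as a collineation.\<close>

lemma code_iso_iff_mult:
  fixes c d :: "nat \<Rightarrow> 'k::{field,finite} vec"
  assumes c: "columns m n c" "spanning m n c" and d: "columns m n d" "spanning m n d"
  shows "code_iso n (code_of m n c) (code_of m n d) \<longleftrightarrow>
    (\<exists>\<sigma>\<in>collineations m. line_mult n c = line_mult n d \<circ> \<sigma>)"
proof
  assume "code_iso n (code_of m n c) (code_of m n d)"
  then obtain \<tau> g \<pi> a where g: "semilinear m \<tau> g" and \<pi>: "\<pi> permutes {..<n}"
    and a: "\<forall>i<n. a i \<noteq> 0" and d_eq: "\<And>i. i < n \<Longrightarrow> d i = a i \<cdot>\<^sub>v g (c (\<pi> i))"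
    by (rule code_isoE[OF c d]) blast
  have \<pi>n: "\<pi> i < n" if "i < n" for i
    using permutes_in_image[OF \<pi>, of i] that by simp
  obtain \<sigma> where \<sigma>: "\<sigma> \<in> collineations m"
    "\<And>v. v \<in> carrier_vec m \<Longrightarrow> \<sigma> (line v) = line (g v)"
    using collineation_of_semilinear[OF g] by blast
  have "line (d i) = \<sigma> (line (c (\<pi> i)))" if "i < n" for i
  proof -
    have "line (d i) = line (g (c (\<pi> i)))"
      unfolding line_eq_iff using a that d_eq by blast
    then show ?thesis using \<sigma>(2)[OF columnsD[OF c(1) \<pi>n[OF that]]] by simp
  qed
  moreover have "inj \<sigma>" using \<sigma>(1) by (auto elim!: collineationsE intro: permutes_inj)
  ultimately have "{i. i < n \<and> line (d i) = \<sigma> P} = {i. i < n \<and> line (c (\<pi> i)) = P}" for P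
    by (auto simp: inj_eq)
  moreover have "card {i. i < n \<and> line (c (\<pi> i)) = P} = card {i. i < n \<and> line (c i) = P}" for P
  proof -
    have "bij_betw \<pi> {i \<in> {..<n}. line (c (\<pi> i)) = P} {i \<in> {..<n}. line (c i) = P}"
      by (rule bij_betw_Collect[OF permutes_imp_bij[OF \<pi>]]) simp
    then show ?thesis by (simp add: bij_betw_same_card)
  qed
  ultimately have "line_mult n c = line_mult n d \<circ> \<sigma>" by (auto simp: line_mult_def fun_eq_iff)
  then show "\<exists>\<sigma>\<in>collineations m. line_mult n c = line_mult n d \<circ> \<sigma>" using \<sigma>(1) by blast
next
  assume "\<exists>\<sigma>\<in>collineations m. line_mult n c = line_mult n d \<circ> \<sigma>"
  then obtain \<sigma> where \<sigma>: "\<sigma> \<in> collineations m" "line_mult n c = line_mult n d \<circ> \<sigma>" by blast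
  obtain \<tau> g where p: "\<sigma> permutes lines m" and g: "semilinear m \<tau> g"
    "\<And>v. v \<in> carrier_vec m \<Longrightarrow> \<sigma> (line v) = line (g v)"
    using \<sigma>(1) by (rule collineationsE) blast
  \<comment> \<open>Equal multiplicities mean equal multisets of lines, and these yield a
    permutation of the coordinates; the scalars are then chosen column by column.\<close>
  have "image_mset (\<lambda>i. line (d i)) (mset_set {..<n}) = image_mset (\<lambda>i. \<sigma> (line (c i))) (mset_set {..<n})"
  proof (rule multiset_eqI)
    fix Q
    obtain P where Q: "Q = \<sigma> P" using permutes_surj[OF p] by (auto simp: surj_def)
    have "card {i. i < n \<and> line (d i) = Q} = card {i. i < n \<and> line (c i) = P}"
      using fun_cong[OF \<sigma>(2), of P] by (simp add: line_mult_def Q)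
    also have "{i. i < n \<and> line (c i) = P} = {i. i < n \<and> \<sigma> (line (c i)) = Q}"
      using permutes_inj[OF p] by (auto simp: Q inj_eq)
    finally show "count (image_mset (\<lambda>i. line (d i)) (mset_set {..<n})) Q
        = count (image_mset (\<lambda>i. \<sigma> (line (c i))) (mset_set {..<n})) Q"
      by (simp add: count_image_mset_eq_card_vimage)
  qed
  then obtain \<pi> where \<pi>: "\<pi> permutes {..<n}" "\<forall>i\<in>{..<n}. line (d i) = \<sigma> (line (c (\<pi> i)))"
    by (rule image_mset_eq_implies_permutes[rotated]) auto
  have \<pi>n: "\<pi> i < n" if "i < n" for i
    using permutes_in_image[OF \<pi>(1), of i] that by simp
  have "\<forall>i. i < n \<longrightarrow> (\<exists>a. a \<noteq> 0 \<and> d i = a \<cdot>\<^sub>v g (c (\<pi> i)))"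
    using \<pi>(2) g(2)[OF columnsD[OF c(1) \<pi>n]] by (simp flip: line_eq_iff)
  then obtain a where a: "\<And>i. i < n \<Longrightarrow> a i \<noteq> 0 \<and> d i = a i \<cdot>\<^sub>v g (c (\<pi> i))" by metis
  show "code_iso n (code_of m n c) (code_of m n d)"
    by (rule code_iso_twist(1)[OF c d(1) g(1) \<pi>(1)]) (use a in auto)
qed

text \<open>Symmetry and transitivity are drawn from inverses and products of collineations. The
  right-hand side has the shape \<open>g = f \<circ> \<sigma>\<close> on which Burnside's lemma
  acts.\<close>

lemma code_class_eq_iff:
  fixes c d :: "nat \<Rightarrow> 'k::{field,finite} vec"
  assumes c: "columns m n c" "spanning m n c" and d: "columns m n d" "spanning m n d"
  shows "code_class m n (code_of m n c) = code_class m n (code_of m n d) \<longleftrightarrow>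
    (\<exists>\<sigma>\<in>collineations m. line_mult n d = line_mult n c \<circ> \<sigma>)"
proof
  have "code_iso n (code_of m n d) (code_of m n d)"
    unfolding code_iso_iff_mult[OF d d] using collineations_id by (metis comp_id)
  then have "code_of m n d \<in> code_class m n (code_of m n d)"
    using linear_code_code_of[OF d] by (simp add: code_class_def)
  moreover assume "code_class m n (code_of m n c) = code_class m n (code_of m n d)"
  ultimately have "code_iso n (code_of m n c) (code_of m n d)" by (auto simp: code_class_def)
  then obtain \<sigma> where \<sigma>: "\<sigma> \<in> collineations m" "line_mult n c = line_mult n d \<circ> \<sigma>"
    unfolding code_iso_iff_mult[OF c d] by blast
  then have "\<sigma> permutes lines m" by (auto elim: collineationsE)
  then have "line_mult n d = line_mult n c \<circ> inv_into UNIV \<sigma>"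
    by (simp add: \<sigma>(2) o_assoc[symmetric] permutes_inv_o)
  then show "\<exists>\<sigma>\<in>collineations m. line_mult n d = line_mult n c \<circ> \<sigma>" using collineations_inv[OF \<sigma>(1)] by blast
next
  have sub: "code_class m n (code_of m n c) \<subseteq> code_class m n (code_of m n d)"
    if c: "columns m n c" "spanning m n c" and d: "columns m n d" "spanning m n d"
      and \<sigma>: "\<sigma> \<in> collineations m" "line_mult n d = line_mult n c \<circ> \<sigma>"
    for c d :: "nat \<Rightarrow> 'k vec" and \<sigma>
  proof
    fix D assume "D \<in> code_class m n (code_of m n c)"
    then have D: "linear_code m n D" "code_iso n (code_of m n c) D" by (auto simp: code_class_def)
    then obtain e where e: "columns m n e" "spanning m n e" "D = code_of m n e"
      by (metis linear_code_columns)
    then obtain \<rho> where \<rho>: "\<rho> \<in> collineations m" "line_mult n c = line_mult n e \<circ> \<rho>"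
      using D(2) code_iso_iff_mult[OF c e(1,2)] by blast
    then have "line_mult n d = line_mult n e \<circ> (\<rho> \<circ> \<sigma>)" using \<sigma>(2) by (simp add: o_assoc)
    then have "code_iso n (code_of m n d) D"
      unfolding e(3) code_iso_iff_mult[OF d e(1,2)] using collineations_comp[OF \<rho>(1) \<sigma>(1)] by blast
    then show "D \<in> code_class m n (code_of m n d)" using D(1) by (simp add: code_class_def)
  qed
  assume "\<exists>\<sigma>\<in>collineations m. line_mult n d = line_mult n c \<circ> \<sigma>"
  then obtain \<sigma> where \<sigma>: "\<sigma> \<in> collineations m" "line_mult n d = line_mult n c \<circ> \<sigma>" by blast
  then have "\<sigma> permutes lines m" by (auto elim: collineationsE)
  then have "line_mult n c = line_mult n d \<circ> inv_into UNIV \<sigma>"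
    by (simp add: \<sigma>(2) o_assoc[symmetric] permutes_inv_o)
  then show "code_class m n (code_of m n c) = code_class m n (code_of m n d)"
    using sub[OF c d \<sigma>] sub[OF d c collineations_inv[OF \<sigma>(1)]] by blast
qed

text \<open>Only the set of lines of positive multiplicity matters, and enlarging it leaves fewer
  vectors \<open>x\<close> orthogonal to all of them.\<close>

definition spanning_mults :: "nat \<Rightarrow> ('k::field vec set \<Rightarrow> nat) set" where
  "spanning_mults m = {f. \<forall>x\<in>carrier_vec m.
     (\<forall>v\<in>carrier_vec m. f (line v) > 0 \<longrightarrow> x \<bullet> v = 0) \<longrightarrow> x = 0\<^sub>v m}"

lemma up_closed_spanning_mults: "up_closed (spanning_mults m)"
  unfolding up_closed_def
proof (intro allI impI)
  fix f g :: "'a vec set \<Rightarrow> nat"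
  assume f: "f \<in> spanning_mults m" and le: "f \<le> g"
  have "g P > 0" if "f P > 0" for P using le_funD[OF le, of P] that by simp
  then show "g \<in> spanning_mults m" using f unfolding spanning_mults_def by blast
qed

lemma spanning_iff_mult:
  fixes c :: "nat \<Rightarrow> 'k::field vec"
  assumes c: "columns m n c"
  shows "spanning m n c \<longleftrightarrow> line_mult n c \<in> spanning_mults m"
proof -
  have "(\<forall>v\<in>carrier_vec m. line_mult n c (line v) > 0 \<longrightarrow> x \<bullet> v = 0) \<longleftrightarrow> (\<forall>i<n. x \<bullet> c i = 0)"
    if x: "x \<in> carrier_vec m" for x
  proof (intro iffI ballI allI impI)
    fix i assume *: "\<forall>v\<in>carrier_vec m. line_mult n c (line v) > 0 \<longrightarrow> x \<bullet> v = 0" and i: "i < n"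
    have "line_mult n c (line (c i)) > 0" using i by (auto simp: line_mult_def card_gt_0_iff)
    then show "x \<bullet> c i = 0" using * columnsD[OF c i] by blast
  next
    fix v assume *: "\<forall>i<n. x \<bullet> c i = 0" and v: "v \<in> carrier_vec m" "line_mult n c (line v) > 0"
    then obtain i where i: "i < n" "line (c i) = line v" by (auto simp: line_mult_def card_gt_0_iff)
    then obtain a where a: "a \<noteq> 0" "c i = a \<cdot>\<^sub>v v" unfolding line_eq_iff by blast
    then have "a * (x \<bullet> v) = 0" using * i(1) v(1) x by (metis scalar_prod_smult_distrib)
    then show "x \<bullet> v = 0" using a(1) by simp
  qed
  then show ?thesis by (simp add: spanning_def spanning_mults_def)
qed

section \<open>Puncturing and the multisets of a family\<close>

lemma skip_bij:
  fixes j n :: nat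
  assumes "j < n"
  shows "bij_betw (\<lambda>i. if i < j then i else Suc i) {..<n - 1} ({..<n} - {j})"
  by (rule bij_betw_byWitness[where f' = "\<lambda>i. if i < j then i else i - 1"])
     (use assms in auto)

lemma line_mult_delete:
  assumes j: "j < n"
  shows "line_mult n c = (line_mult (n - 1) (\<lambda>i. c (if i < j then i else Suc i)))
    (line (c j) := Suc (line_mult (n - 1) (\<lambda>i. c (if i < j then i else Suc i)) (line (c j))))"
proof
  fix P
  let ?s = "\<lambda>i. if i < j then i else Suc i"
  have "bij_betw ?s {i \<in> {..<n - 1}. line (c (?s i)) = P} {i \<in> {..<n} - {j}. line (c i) = P}"
    by (rule bij_betw_Collect[OF skip_bij[OF j]]) simp
  then have *: "line_mult (n - 1) (\<lambda>i. c (?s i)) P = card {i \<in> {..<n} - {j}. line (c i) = P}"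
    unfolding line_mult_def by (simp add: bij_betw_same_card)
  have "{i. i < n \<and> line (c i) = P}
      = {i \<in> {..<n} - {j}. line (c i) = P} \<union> (if line (c j) = P then {j} else {})"
    using j by auto
  then have "line_mult n c P = line_mult (n - 1) (\<lambda>i. c (?s i)) P + (if line (c j) = P then 1 else 0)"
    unfolding line_mult_def[of n] * by simp
  then show "line_mult n c P = ((line_mult (n - 1) (\<lambda>i. c (?s i)))
      (line (c j) := Suc (line_mult (n - 1) (\<lambda>i. c (?s i)) (line (c j))))) P"
    by auto
qed

lemma puncture_code_of:
  assumes "j < n"
  shows "puncture j (code_of m n c) = code_of m (n - 1) (\<lambda>i. c (if i < j then i else Suc i))"
proof -
  have "delete_coord j (word n c x) = word (n - 1) (\<lambda>i. c (if i < j then i else Suc i)) x" for x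
    using assms by (intro eq_vecI) (auto simp: delete_coord_def word_def)
  then show ?thesis by (simp add: puncture_def code_of_def image_image)
qed

definition mults_of :: "nat \<Rightarrow> 'k::field vec set set set \<Rightarrow> ('k vec set \<Rightarrow> nat) set" where
  "mults_of m \<C> = {line_mult n c | n c. columns m n c \<and> spanning m n c \<and> code_class m n (code_of m n c) \<in> \<C>}"

text \<open>Membership does not depend on the matrix: the total recovers the length, and equal
  multiplicities give equal classes through the identity collineation.\<close>

lemma mults_of_iff:
  fixes c :: "nat \<Rightarrow> 'k::{field,finite} vec"
  assumes c: "columns m n c" "spanning m n c"
  shows "line_mult n c \<in> mults_of m \<C> \<longleftrightarrow> code_class m n (code_of m n c) \<in> \<C>"
proof
  assume "line_mult n c \<in> mults_of m \<C>"
  then obtain k d where d: "columns m k d" "spanning m k d" "code_class m k (code_of m k d) \<in> \<C>"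
    and eq: "line_mult n c = line_mult k d"
    unfolding mults_of_def by blast
  have "n = k" using sum_line_mult[OF c(1)] sum_line_mult[OF d(1)] eq by simp
  moreover have "code_class m n (code_of m n c) = code_class m n (code_of m n d)"
    using code_class_eq_iff[OF c, of d] d eq \<open>n = k\<close> collineations_id by (metis comp_id)
  ultimately show "code_class m n (code_of m n c) \<in> \<C>" using d by simp
qed (use c in \<open>auto simp: mults_of_def\<close>)

lemma mults_of_spanning: "mults_of m \<C> \<subseteq> spanning_mults m"
  using spanning_iff_mult by (fastforce simp: mults_of_def)

text \<open>Applying to every column a semilinear map that induces the inverse of
  \<open>\<sigma>\<close> produces an isomorphic code with multiplicities
  \<open>f \<circ> \<sigma>\<close>.\<close>

lemma mults_of_collineation:
  fixes \<C> :: "'k::{field,finite} vec set set set"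
  assumes f: "f \<in> mults_of m \<C>" and \<sigma>: "\<sigma> \<in> collineations m"
  shows "f \<circ> \<sigma> \<in> mults_of m \<C>"
proof -
  obtain n c where c: "columns m n c" "spanning m n c" "code_class m n (code_of m n c) \<in> \<C>"
    and f_eq: "f = line_mult n c"
    using f unfolding mults_of_def by blast
  let ?\<rho> = "inv_into UNIV \<sigma>"
  have p: "\<sigma> permutes lines m" using \<sigma> by (auto elim: collineationsE)
  obtain \<tau> g where g: "semilinear m \<tau> g" "\<And>v. v \<in> carrier_vec m \<Longrightarrow> ?\<rho> (line v) = line (g v)"
    using collineations_inv[OF \<sigma>] by (rule collineationsE) blast
  define d where "d i = g (c i)" for i
  have d: "columns m n d" using c(1) by (simp add: columns_def d_def semilinearD[OF g(1)])
  have "spanning m n d"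
    by (rule code_iso_twist(2)[OF c(1,2) d g(1), of "\<lambda>i. i" "\<lambda>i. 1"])
       (simp_all add: d_def permutes_id[unfolded id_def])
  moreover have "line_mult n d = line_mult n c \<circ> \<sigma>"
  proof
    fix P
    have "line (d i) = P \<longleftrightarrow> line (c i) = \<sigma> P" if "i < n" for i
      using permutes_inv_eq[OF p, of "line (c i)" P]
      unfolding g(2)[OF columnsD[OF c(1) that]] d_def by auto
    then show "line_mult n d P = (line_mult n c \<circ> \<sigma>) P" by (simp add: line_mult_def cong: conj_cong)
  qed
  moreover have "code_class m n (code_of m n c) = code_class m n (code_of m n d)"
    unfolding code_class_eq_iff[OF c(1,2) d calculation(1)] using calculation(2) \<sigma> by blast
  ultimately show ?thesis using c(3) d unfolding mults_of_def f_eq by (metis (mono_tags, lifting) mem_Collect_eq)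
qed

text \<open>The descent from \<open>f\<close> to \<open>h\<close> removes one column at a time.
  Every multiset on the way lies above the spanning \<open>h\<close>, hence spans, so no puncturing
  lowers the dimension and each one is allowed.\<close>

lemma mults_of_down:
  fixes \<C> :: "'k::{field,finite} vec set set set"
  assumes \<C>: "puncturing_closed m \<C>"
    and f: "f \<in> mults_of m \<C>"
    and h: "h \<in> supported_on (lines m)" "h \<in> spanning_mults m" "h \<le> f"
  shows "h \<in> mults_of m \<C>"
  using f h(3)
proof (induction "sum f (lines m)" arbitrary: f rule: less_induct)
  case less
  show ?case
  proof (cases "h = f")
    case False
    then obtain P where P: "h P < f P"
      using less.prems(2) by (metis le_fun_def le_neq_implies_less ext)
    obtain n c where c: "columns m n c" "spanning m n c" "code_class m n (code_of m n c) \<in> \<C>"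
      and f_eq: "f = line_mult n c"
      using less.prems(1) unfolding mults_of_def by blast
    have "line_mult n c P > 0" using P f_eq by simp
    \<comment> \<open>A column on a line where \<open>f\<close> strictly exceeds \<open>h\<close>,
      so that deleting it keeps the multiplicities above \<open>h\<close>.\<close>
    then obtain j where j: "j < n" "line (c j) = P" by (auto simp: line_mult_def card_gt_0_iff)
    define d where "d = (\<lambda>i. c (if i < j then i else Suc i))"
    have d: "columns m (n - 1) d" using c(1) j(1) by (auto simp: columns_def d_def)
    have f_d: "f = (line_mult (n - 1) d)(P := Suc (line_mult (n - 1) d P))"
      using line_mult_delete[OF j(1), of c] by (simp add: f_eq d_def j(2))
    have le: "h \<le> line_mult (n - 1) d"
    proof (rule le_funI)
      fix Q show "h Q \<le> line_mult (n - 1) d Q"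
        using le_funD[OF less.prems(2), of Q] P by (cases "Q = P") (simp_all add: f_d)
    qed
    then have "line_mult (n - 1) d \<in> spanning_mults m"
      by (rule up_closedD[OF up_closed_spanning_mults h(2)])
    then have sp: "spanning m (n - 1) d" using spanning_iff_mult[OF d] by blast
    have punct: "puncture j (code_of m n c) = code_of m (n - 1) d"
      using puncture_code_of[OF j(1)] by (simp add: d_def)
    have "code_dim (n - 1) (puncture j (code_of m n c)) = code_dim n (code_of m n c)"
      using linear_code_code_of[OF c(1,2)] linear_code_code_of[OF d sp]
      by (simp add: linear_code_def punct)
    then have "code_class m (n - 1) (puncture j (code_of m n c)) \<in> \<C>"
      using \<C> c(3) j(1) linear_code_code_of[OF c(1,2)] unfolding puncturing_closed_def by blast
    then have "line_mult (n - 1) d \<in> mults_of m \<C>" using mults_of_iff[OF d sp] by (simp add: punct)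
    moreover have "sum (line_mult (n - 1) d) (lines m) < sum f (lines m)"
      using sum_line_mult[OF d] sum_line_mult[OF c(1)] j(1) f_eq by simp
    ultimately show ?thesis using less.hyps le by blast
  qed (use less.prems in simp)
qed

theorem theorem1p9:
  fixes m :: nat and \<C> :: "'k::{field,finite} vec set set set"
  assumes "\<C> \<subseteq> (\<Union>n. code_classes m n)"
    and "puncturing_closed m \<C>"
  shows "\<exists>f n\<^sub>0. quasipolynomial f \<and>
           (\<forall>n\<ge>n\<^sub>0. real (card (\<C> \<inter> code_classes m n)) = f (int n))"
proof -
  let ?X = "lines m :: 'k vec set set" and ?U = "spanning_mults m :: ('k vec set \<Rightarrow> nat) set"
  \<comment> \<open>The up-closure of the spanning multisets outside the family. By
    \<open>mults_of_down\<close> no member of the family lies above such a multiset, so removing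
    \<open>V\<close> from the spanning ones leaves exactly the family.\<close>
  define V where "V = {f. \<exists>h. h \<in> supported_on ?X \<and> h \<in> ?U - mults_of m \<C> \<and> h \<le> f}"
  define cols where "cols f = (SOME c. columns m (sum f ?X) c \<and> line_mult (sum f ?X) c = f)"
    for f :: "'k vec set \<Rightarrow> nat"
  define \<Phi> where "\<Phi> f = code_class m (sum f ?X) (code_of m (sum f ?X) (cols f))" for f
  have V: "up_closed V" unfolding up_closed_def V_def using order_trans by blast
  have VU: "V \<subseteq> ?U" unfolding V_def using up_closedD[OF up_closed_spanning_mults] by blast
  have UV: "f \<in> ?U - V \<longleftrightarrow> f \<in> mults_of m \<C>" if f: "f \<in> supported_on ?X" for f
  proof
    assume "f \<in> mults_of m \<C>"
    then show "f \<in> ?U - V"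
      using mults_of_down[OF assms(2)] mults_of_spanning unfolding V_def by blast
  qed (use f in \<open>auto simp: V_def\<close>)
  have cols: "columns m (sum f ?X) (cols f)" "line_mult (sum f ?X) (cols f) = f"
    if "f \<in> supported_on ?X" for f
    using someI_ex[OF line_mult_realise[OF that]] by (simp_all add: cols_def)
  have spanning_cols: "spanning m (sum f ?X) (cols f)" if "f \<in> supported_on ?X" "f \<in> ?U" for f
    using spanning_iff_mult cols that by metis
  have img: "\<Phi> ` {f \<in> supported_on ?X. f \<in> ?U - V \<and> sum f ?X = n} = \<C> \<inter> code_classes m n" for n
  proof
    show "\<Phi> ` {f \<in> supported_on ?X. f \<in> ?U - V \<and> sum f ?X = n} \<subseteq> \<C> \<inter> code_classes m n"
    proof (intro image_subsetI)
      fix f assume "f \<in> {f \<in> supported_on ?X. f \<in> ?U - V \<and> sum f ?X = n}"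
      then have f: "f \<in> supported_on ?X" "f \<in> ?U" "f \<in> mults_of m \<C>" "sum f ?X = n"
        using UV by auto
      note c = cols(1)[OF f(1)] spanning_cols[OF f(1,2)]
      have "\<Phi> f \<in> \<C>" using mults_of_iff[OF c] f(3) by (simp add: cols(2)[OF f(1)] \<Phi>_def)
      moreover have "\<Phi> f \<in> code_classes m n"
        unfolding \<Phi>_def code_classes_def using linear_code_code_of[OF c] f(4) by blast
      ultimately show "\<Phi> f \<in> \<C> \<inter> code_classes m n" by blast
    qed
    show "\<C> \<inter> code_classes m n \<subseteq> \<Phi> ` {f \<in> supported_on ?X. f \<in> ?U - V \<and> sum f ?X = n}"
    proof
      fix K assume K: "K \<in> \<C> \<inter> code_classes m n"
      then obtain C where C: "linear_code m n C" "K = code_class m n C"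
        unfolding code_classes_def by blast
      obtain c where c: "columns m n c" "spanning m n c" "C = code_of m n c"
        using C(1) by (rule linear_code_columns)
      let ?f = "line_mult n c"
      have f: "?f \<in> supported_on ?X" "sum ?f ?X = n" "?f \<in> ?U"
        using line_mult_supported sum_line_mult spanning_iff_mult c by blast+
      have "?f \<in> mults_of m \<C>" using mults_of_iff[OF c(1,2)] K C c by simp
      then have "?f \<in> ?U - V" using UV f by blast
      moreover have "\<Phi> ?f = K"
      proof -
        \<comment> \<open>The matrix chosen for \<open>?f\<close> need not be \<open>c\<close>, but
          it has the same multiplicities and hence the same class.\<close>
        have d: "columns m n (cols ?f)" "spanning m n (cols ?f)" "line_mult n (cols ?f) = ?f"
          using cols[OF f(1)] spanning_cols[OF f(1,3)] f(2) by simp_all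
        have "code_class m n (code_of m n (cols ?f)) = code_class m n (code_of m n c)"
          unfolding code_class_eq_iff[OF d(1,2) c(1,2)] d(3) using collineations_id by (metis comp_id)
        then show ?thesis by (simp add: \<Phi>_def f(2) C(2) c(3))
      qed
      ultimately show "K \<in> \<Phi> ` {f \<in> supported_on ?X. f \<in> ?U - V \<and> sum f ?X = n}"
        using f by blast
    qed
  qed
  have "eventually_qp (\<lambda>n. real (card (\<Phi> ` {f \<in> supported_on ?X. f \<in> ?U - V \<and> sum f ?X = n})))"
  proof (rule eventually_qp_orbits[OF finite_lines _ _ collineations_comp collineations_inv
        up_closed_spanning_mults V VU])
    show "collineations m \<noteq> {}" using collineations_id by blast
    show "\<sigma> permutes ?X" if "\<sigma> \<in> collineations m" for \<sigma>
      using that by (rule collineationsE)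
    show "f \<circ> \<sigma> \<in> ?U - V"
      if f: "f \<in> supported_on ?X" "f \<in> ?U - V" and \<sigma>: "\<sigma> \<in> collineations m" for f \<sigma>
    proof -
      have "\<sigma> permutes ?X" using \<sigma> by (rule collineationsE)
      then have "f \<circ> \<sigma> \<in> supported_on ?X" using f(1) by (simp add: supported_on_def permutes_not_in)
      then show ?thesis using UV f mults_of_collineation \<sigma> by blast
    qed
    show "\<Phi> f = \<Phi> g \<longleftrightarrow> (\<exists>\<sigma>\<in>collineations m. g = f \<circ> \<sigma>)"
      if f: "f \<in> supported_on ?X" "f \<in> ?U - V" and g: "g \<in> supported_on ?X" "g \<in> ?U - V"
        and eq: "sum f ?X = sum g ?X" for f g
      unfolding \<Phi>_def eq
      using code_class_eq_iff[of m "sum g ?X" "cols f" "cols g"]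
        cols[OF f(1)] cols[OF g(1)] spanning_cols[of f] spanning_cols[of g] f g eq
      by simp
  qed
  then show ?thesis unfolding img by (rule eventually_qp_imp_quasipolynomial)
qed

end
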